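(* Let $G\in\mathcal{QD}1$, $T=T(G)$, $g\in G$, and let $(g)_{AI}$ be the absolute ideal of the group $G$ generated by the element $g$. Then $(g)_{AI}=G(\mathrm{char}\,g)$ if $g\notin T$, and $(g)_{AI}=T(\mathrm{char}\,g)$ if $g\in T$.
   Context: All groups are abelian, written additively; $P$ is the set of all primes, $T(G)$ is the torsion part of $G$. A group $G$ is quotient divisible if it contains no nonzero divisible torsion subgroup but contains a free subgroup $F$ of finite rank such that $G/F$ is a divisible torsion group. $\mathcal{QD}1$ is the class of all quotient divisible groups of torsion-free rank 1. A multiplication on $G$ is a homomorphism $\mu:G\otimes G\to G$, written $g_1\times g_2=\mu(g_1\otimes g_2)$; a ring $(G,\times)$ on $G$ is $G$ equipped with a multiplication $\times$ (associativity, commutativity and a unit are not required). An absolute ideal of $G$ is a subgroup of $G$ that is an ideal in every ring on $G$. The principal absolute ideal $(g)_{AI}$ generated by $g$ is the smallest absolute ideal of $G$ containing $g$. For $g\in G$, $h_p(g)\in\{0,1,2,\ldots,\infty\}$ is the $p$-height of $g$ in $G$, and $\mathrm{char}\,g$ is the function $P\to\{0,1,2,\ldots,\infty\}$, $p\mapsto h_p(g)$. Such functions are compared pointwise. For a group $A$ and a function $\eta:P\to\{0,1,2,\ldots,\infty\}$, $A(\eta)=\{x\in A\mid \mathrm{char}\,x\ge\eta\}$, characteristics of $x$ being computed in $A$. *)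

theory Defs
  imports "HOL-Algebra.Algebra" "HOL-Library.Extended_Nat" "HOL-Computational_Algebra.Primes"
begin

text \<open>
  Abelian groups are HOL-Algebra commutative groups. The source writes them additively, the
  library multiplicatively: \<open>\<otimes>\<close>, \<open>\<one>\<close> and \<open>x [^] n\<close> stand for \<open>x + y\<close>, \<open>0\<close> and \<open>n x\<close>.
  A subgroup \<open>H\<close> of \<open>G\<close>, regarded as a group in its own right, is \<open>G\<lparr>carrier := H\<rparr>\<close>.
\<close>

definition torsion_part :: "('a, 'b) monoid_scheme \<Rightarrow> 'a set" where
  "torsion_part G = {x \<in> carrier G. \<exists>n::nat. 0 < n \<and> x [^]\<^bsub>G\<^esub> n = \<one>\<^bsub>G\<^esub>}"

definition torsion_group :: "('a, 'b) monoid_scheme \<Rightarrow> bool" where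
  "torsion_group G \<longleftrightarrow> torsion_part G = carrier G"

definition divisible_group :: "('a, 'b) monoid_scheme \<Rightarrow> bool" where
  "divisible_group G \<longleftrightarrow>
     (\<forall>n::nat. 0 < n \<longrightarrow> (\<forall>x \<in> carrier G. \<exists>y \<in> carrier G. y [^]\<^bsub>G\<^esub> n = x))"

definition free_finite_rank :: "('a, 'b) monoid_scheme \<Rightarrow> bool" where
  "free_finite_rank F \<longleftrightarrow> (\<exists>n::nat. F \<cong> free_Abelian_group {..<n})"

definition quotient_divisible :: "('a, 'b) monoid_scheme \<Rightarrow> bool" where
  "quotient_divisible G \<longleftrightarrow>
     comm_group G \<and>
     (\<forall>D. subgroup D G \<and> divisible_group (G\<lparr>carrier := D\<rparr>) \<and> torsion_group (G\<lparr>carrier := D\<rparr>)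
          \<longrightarrow> D = {\<one>\<^bsub>G\<^esub>}) \<and>
     (\<exists>F. subgroup F G \<and> free_finite_rank (G\<lparr>carrier := F\<rparr>) \<and>
          divisible_group (G Mod F) \<and> torsion_group (G Mod F))"

definition independent_set :: "('a, 'b) monoid_scheme \<Rightarrow> 'a set \<Rightarrow> bool" where
  "independent_set G S \<longleftrightarrow>
     S \<subseteq> carrier G \<and>
     (\<forall>A (c :: 'a \<Rightarrow> int). finite A \<and> A \<subseteq> S \<and> finprod G (\<lambda>s. s [^]\<^bsub>G\<^esub> c s) A = \<one>\<^bsub>G\<^esub>
          \<longrightarrow> (\<forall>s \<in> A. c s = 0))"

text \<open>
  Members of an independent set in the sense above have infinite order, so a maximal such set
  has the cardinality of a basis of \<open>\<rat> \<otimes> G\<close>.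
\<close>

definition has_torsion_free_rank :: "('a, 'b) monoid_scheme \<Rightarrow> nat \<Rightarrow> bool" where
  "has_torsion_free_rank G r \<longleftrightarrow>
     (\<exists>S. independent_set G S \<and> (\<forall>S'. independent_set G S' \<and> S \<subseteq> S' \<longrightarrow> S' = S) \<and>
          finite S \<and> card S = r)"

definition QD1 :: "('a, 'b) monoid_scheme set" where
  "QD1 = {G. quotient_divisible G \<and> has_torsion_free_rank G 1}"

definition tensor_relations ::
    "('a, 'b) monoid_scheme \<Rightarrow> ('c, 'd) monoid_scheme \<Rightarrow> (('a \<times> 'c) \<Rightarrow>\<^sub>0 int) set" where
  "tensor_relations G H =
     {frag_of (x \<otimes>\<^bsub>G\<^esub> x', y) - frag_of (x, y) - frag_of (x', y) | x x' y.
        x \<in> carrier G \<and> x' \<in> carrier G \<and> y \<in> carrier H} \<union>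
     {frag_of (x, y \<otimes>\<^bsub>H\<^esub> y') - frag_of (x, y) - frag_of (x, y') | x y y'.
        x \<in> carrier G \<and> y \<in> carrier H \<and> y' \<in> carrier H}"

definition tensor_kernel ::
    "('a, 'b) monoid_scheme \<Rightarrow> ('c, 'd) monoid_scheme \<Rightarrow> (('a \<times> 'c) \<Rightarrow>\<^sub>0 int) set" where
  "tensor_kernel G H =
     generate (free_Abelian_group (carrier G \<times> carrier H)) (tensor_relations G H)"

definition tensor_product ::
    "('a, 'b) monoid_scheme \<Rightarrow> ('c, 'd) monoid_scheme \<Rightarrow> (('a \<times> 'c) \<Rightarrow>\<^sub>0 int) set monoid" where
  "tensor_product G H = free_Abelian_group (carrier G \<times> carrier H) Mod tensor_kernel G H"

definition pure_tensor ::
    "('a, 'b) monoid_scheme \<Rightarrow> ('c, 'd) monoid_scheme \<Rightarrow> 'a \<Rightarrow> 'c \<Rightarrow> (('a \<times> 'c) \<Rightarrow>\<^sub>0 int) set" where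
  "pure_tensor G H x y =
     tensor_kernel G H #>\<^bsub>free_Abelian_group (carrier G \<times> carrier H)\<^esub> frag_of (x, y)"

text \<open>
  The multiplications on \<open>G\<close>, and the product \<open>g\<^sub>1 \<times> g\<^sub>2 = \<mu> (g\<^sub>1 \<otimes> g\<^sub>2)\<close> of the ring
  determined by \<open>\<mu>\<close>.
\<close>

definition multiplications ::
    "('a, 'b) monoid_scheme \<Rightarrow> ((('a \<times> 'a) \<Rightarrow>\<^sub>0 int) set \<Rightarrow> 'a) set" where
  "multiplications G = hom (tensor_product G G) G"

definition ring_product ::
    "('a, 'b) monoid_scheme \<Rightarrow> ((('a \<times> 'a) \<Rightarrow>\<^sub>0 int) set \<Rightarrow> 'a) \<Rightarrow> 'a \<Rightarrow> 'a \<Rightarrow> 'a" where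
  "ring_product G \<mu> x y = \<mu> (pure_tensor G G x y)"

definition ideal_in_ring_on ::
    "('a, 'b) monoid_scheme \<Rightarrow> ((('a \<times> 'a) \<Rightarrow>\<^sub>0 int) set \<Rightarrow> 'a) \<Rightarrow> 'a set \<Rightarrow> bool" where
  "ideal_in_ring_on G \<mu> I \<longleftrightarrow>
     subgroup I G \<and>
     (\<forall>x \<in> I. \<forall>y \<in> carrier G. ring_product G \<mu> x y \<in> I \<and> ring_product G \<mu> y x \<in> I)"

definition absolute_ideal :: "('a, 'b) monoid_scheme \<Rightarrow> 'a set \<Rightarrow> bool" where
  "absolute_ideal G I \<longleftrightarrow>
     subgroup I G \<and> (\<forall>\<mu> \<in> multiplications G. ideal_in_ring_on G \<mu> I)"

definition principal_AI :: "('a, 'b) monoid_scheme \<Rightarrow> 'a \<Rightarrow> 'a set" where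
  "principal_AI G g = \<Inter>{I. absolute_ideal G I \<and> g \<in> I}"

text \<open>In \<^typ>\<open>enat\<close> the supremum of an infinite set of naturals is \<open>\<infinity>\<close>.\<close>

definition height :: "('a, 'b) monoid_scheme \<Rightarrow> nat \<Rightarrow> 'a \<Rightarrow> enat" where
  "height G p g = Sup {enat k | k. \<exists>y \<in> carrier G. y [^]\<^bsub>G\<^esub> (p ^ k) = g}"

text \<open>Functions on the set of primes are total functions compared at primes only.\<close>

definition characteristic :: "('a, 'b) monoid_scheme \<Rightarrow> 'a \<Rightarrow> nat \<Rightarrow> enat" where
  "characteristic G g = (\<lambda>p. height G p g)"

definition char_le :: "(nat \<Rightarrow> enat) \<Rightarrow> (nat \<Rightarrow> enat) \<Rightarrow> bool" where
  "char_le \<eta> \<theta> \<longleftrightarrow> (\<forall>p. Factorial_Ring.prime p \<longrightarrow> \<eta> p \<le> \<theta> p)"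

definition char_subgroup :: "('a, 'b) monoid_scheme \<Rightarrow> (nat \<Rightarrow> enat) \<Rightarrow> 'a set" where
  "char_subgroup A \<eta> = {x \<in> carrier A. char_le \<eta> (characteristic A x)}"


lemma tensor_relations_subset:
  assumes "group G" "group H"
  shows "tensor_relations G H \<subseteq> carrier (free_Abelian_group (carrier G \<times> carrier H))"
proof -
  interpret G: group G by fact
  interpret H: group H by fact
  have *: "Poly_Mapping.keys (frag_of a - frag_of b - frag_of c) \<subseteq> {a, b, c}"
    for a b c :: "'a \<times> 'c"
    by (auto dest!: subsetD[OF keys_diff])
  show ?thesis
    unfolding tensor_relations_def
    by (auto dest!: subsetD[OF *])
qed

lemma tensor_kernel_normal:
  assumes "group G" "group H"
  shows "tensor_kernel G H \<lhd> free_Abelian_group (carrier G \<times> carrier H)"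
proof -
  interpret F: comm_group "free_Abelian_group (carrier G \<times> carrier H)"
    by (rule abelian_free_Abelian_group)
  show ?thesis
    unfolding tensor_kernel_def
    by (intro F.subgroup_imp_normal F.generate_is_subgroup tensor_relations_subset assms)
qed

lemma pure_tensor_closed:
  assumes "x \<in> carrier G" "y \<in> carrier H"
  shows "pure_tensor G H x y \<in> carrier (tensor_product G H)"
  using assms by (auto simp: pure_tensor_def tensor_product_def carrier_FactGroup)

lemma tensor_mult:
  assumes "group G" "group H"
    and "a \<in> carrier (free_Abelian_group (carrier G \<times> carrier H))"
    and "b \<in> carrier (free_Abelian_group (carrier G \<times> carrier H))"
  shows "(tensor_kernel G H #>\<^bsub>free_Abelian_group (carrier G \<times> carrier H)\<^esub> a)
           \<otimes>\<^bsub>tensor_product G H\<^esub>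
         (tensor_kernel G H #>\<^bsub>free_Abelian_group (carrier G \<times> carrier H)\<^esub> b) =
         tensor_kernel G H #>\<^bsub>free_Abelian_group (carrier G \<times> carrier H)\<^esub> (a + b)"
  using normal.rcos_sum[OF tensor_kernel_normal[OF assms(1,2)] assms(3,4)]
  by (simp add: tensor_product_def)

lemma tensor_eqI:
  assumes "group G" "group H"
    and "a \<in> carrier (free_Abelian_group (carrier G \<times> carrier H))"
    and "b \<in> carrier (free_Abelian_group (carrier G \<times> carrier H))"
    and "a - b \<in> tensor_relations G H"
  shows "tensor_kernel G H #>\<^bsub>free_Abelian_group (carrier G \<times> carrier H)\<^esub> a =
         tensor_kernel G H #>\<^bsub>free_Abelian_group (carrier G \<times> carrier H)\<^esub> b"
proof -
  let ?F = "free_Abelian_group (carrier G \<times> carrier H)"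
  interpret F: comm_group ?F
    by (rule abelian_free_Abelian_group)
  interpret K: normal "tensor_kernel G H" ?F
    by (rule tensor_kernel_normal[OF assms(1,2)])
  have "a - b \<in> tensor_kernel G H"
    unfolding tensor_kernel_def using assms(5) by (rule generate.incl)
  moreover have "a = (a - b) \<otimes>\<^bsub>?F\<^esub> b" by simp
  ultimately have "a \<in> tensor_kernel G H #>\<^bsub>?F\<^esub> b"
    unfolding r_coset_def by blast
  then show ?thesis
    using F.repr_independence[OF _ assms(4) K.subgroup_axioms] by metis
qed

lemma pure_tensor_mult_left:
  assumes "group G" "group H" "x \<in> carrier G" "x' \<in> carrier G" "y \<in> carrier H"
  shows "pure_tensor G H (x \<otimes>\<^bsub>G\<^esub> x') y =
         pure_tensor G H x y \<otimes>\<^bsub>tensor_product G H\<^esub> pure_tensor G H x' y"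
proof -
  interpret G: group G by fact
  have "frag_of (x \<otimes>\<^bsub>G\<^esub> x', y) - (frag_of (x, y) + frag_of (x', y)) \<in> tensor_relations G H"
    unfolding tensor_relations_def diff_diff_eq using assms by blast
  then show ?thesis
    unfolding pure_tensor_def using assms
    by (subst tensor_mult[OF assms(1,2)], simp, simp, intro tensor_eqI[OF assms(1,2)])
       (auto simp: G.m_closed dest!: subsetD[OF keys_add])
qed

lemma pure_tensor_mult_right:
  assumes "group G" "group H" "x \<in> carrier G" "y \<in> carrier H" "y' \<in> carrier H"
  shows "pure_tensor G H x (y \<otimes>\<^bsub>H\<^esub> y') =
         pure_tensor G H x y \<otimes>\<^bsub>tensor_product G H\<^esub> pure_tensor G H x y'"
proof -
  interpret H: group H by fact
  have "frag_of (x, y \<otimes>\<^bsub>H\<^esub> y') - (frag_of (x, y) + frag_of (x, y')) \<in> tensor_relations G H"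
    unfolding tensor_relations_def diff_diff_eq using assms by blast
  then show ?thesis
    unfolding pure_tensor_def using assms
    by (subst tensor_mult[OF assms(1,2)], simp, simp, intro tensor_eqI[OF assms(1,2)])
       (auto simp: H.m_closed dest!: subsetD[OF keys_add])
qed

lemma ring_product_biadditive:
  assumes "comm_group G" "\<mu> \<in> multiplications G"
    and "x \<in> carrier G" "y \<in> carrier G" "z \<in> carrier G"
  shows "ring_product G \<mu> x y \<in> carrier G"
    and "ring_product G \<mu> (x \<otimes>\<^bsub>G\<^esub> y) z = ring_product G \<mu> x z \<otimes>\<^bsub>G\<^esub> ring_product G \<mu> y z"
    and "ring_product G \<mu> x (y \<otimes>\<^bsub>G\<^esub> z) = ring_product G \<mu> x y \<otimes>\<^bsub>G\<^esub> ring_product G \<mu> x z"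
proof -
  interpret G: comm_group G by fact
  have \<mu>: "\<mu> \<in> hom (tensor_product G G) G"
    using assms(2) by (simp add: multiplications_def)
  show "ring_product G \<mu> x y \<in> carrier G"
    unfolding ring_product_def using \<mu> assms by (blast intro: hom_in_carrier pure_tensor_closed)
  show "ring_product G \<mu> (x \<otimes>\<^bsub>G\<^esub> y) z = ring_product G \<mu> x z \<otimes>\<^bsub>G\<^esub> ring_product G \<mu> y z"
    unfolding ring_product_def
    using assms by (simp add: pure_tensor_mult_left hom_mult[OF \<mu>] pure_tensor_closed)
  show "ring_product G \<mu> x (y \<otimes>\<^bsub>G\<^esub> z) = ring_product G \<mu> x y \<otimes>\<^bsub>G\<^esub> ring_product G \<mu> x z"
    unfolding ring_product_def
    using assms by (simp add: pure_tensor_mult_right hom_mult[OF \<mu>] pure_tensor_closed)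
qed

lemma biadditive_imp_multiplication:
  assumes "comm_group G"
    and clo: "\<And>x y. \<lbrakk>x \<in> carrier G; y \<in> carrier G\<rbrakk> \<Longrightarrow> m x y \<in> carrier G"
    and left: "\<And>x y z. \<lbrakk>x \<in> carrier G; y \<in> carrier G; z \<in> carrier G\<rbrakk>
                 \<Longrightarrow> m (x \<otimes>\<^bsub>G\<^esub> y) z = m x z \<otimes>\<^bsub>G\<^esub> m y z"
    and right: "\<And>x y z. \<lbrakk>x \<in> carrier G; y \<in> carrier G; z \<in> carrier G\<rbrakk>
                 \<Longrightarrow> m x (y \<otimes>\<^bsub>G\<^esub> z) = m x y \<otimes>\<^bsub>G\<^esub> m x z"
  obtains \<mu> where "\<mu> \<in> multiplications G"
    and "\<And>x y. \<lbrakk>x \<in> carrier G; y \<in> carrier G\<rbrakk> \<Longrightarrow> ring_product G \<mu> x y = m x y"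
proof -
  interpret G: comm_group G by fact
  let ?S = "carrier G \<times> carrier G"
  let ?F = "free_Abelian_group ?S"
  interpret F: comm_group ?F
    by (rule abelian_free_Abelian_group)
  have "(\<lambda>(x, y). m x y) ` ?S \<subseteq> carrier G" using clo by auto
  then obtain h where h: "h \<in> hom ?F G"
    and h_frag: "\<And>z. z \<in> ?S \<Longrightarrow> h (frag_of z) = (\<lambda>(x, y). m x y) z"
    using G.free_Abelian_group_universal by blast
  interpret h: group_hom ?F G h
    by (simp add: group_hom_def group_hom_axioms_def h)
  have inS: "frag_of z \<in> carrier ?F" if "z \<in> ?S" for z
    using that by simp
  have diff: "h (a - b - c) = h a \<otimes>\<^bsub>G\<^esub> inv\<^bsub>G\<^esub> h b \<otimes>\<^bsub>G\<^esub> inv\<^bsub>G\<^esub> h c"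
    if "a \<in> carrier ?F" "b \<in> carrier ?F" "c \<in> carrier ?F" for a b c
  proof -
    have "a - b - c = a \<otimes>\<^bsub>?F\<^esub> inv\<^bsub>?F\<^esub> b \<otimes>\<^bsub>?F\<^esub> inv\<^bsub>?F\<^esub> c"
      using that by simp
    then show ?thesis
      using that by (metis F.inv_closed F.m_closed h.hom_inv h.hom_mult)
  qed
  have canc: "(u \<otimes>\<^bsub>G\<^esub> v) \<otimes>\<^bsub>G\<^esub> inv\<^bsub>G\<^esub> u \<otimes>\<^bsub>G\<^esub> inv\<^bsub>G\<^esub> v = \<one>\<^bsub>G\<^esub>"
    if "u \<in> carrier G" "v \<in> carrier G" for u v
    using that by (simp add: G.m_comm[of u v] G.m_assoc G.inv_solve_right')
  have rel: "h a = \<one>\<^bsub>G\<^esub>" if "a \<in> tensor_relations G G" for a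
    using that unfolding tensor_relations_def
    by (auto simp: diff inS h_frag left right canc clo simp del: carrier_free_Abelian_group_iff)
  have ker: "h a = \<one>\<^bsub>G\<^esub>" if "a \<in> tensor_kernel G G" for a
  proof -
    have "tensor_kernel G G \<subseteq> kernel ?F G h"
      unfolding tensor_kernel_def
      using rel tensor_relations_subset[OF G.group_axioms G.group_axioms]
      by (intro F.generate_subgroup_incl h.subgroup_kernel)
         (auto simp: kernel_def simp del: carrier_free_Abelian_group_iff)
    then show ?thesis using that by (auto simp: kernel_def)
  qed
  have N: "tensor_kernel G G \<lhd> ?F"
    by (rule tensor_kernel_normal) (rule G.group_axioms)+
  interpret N: normal "tensor_kernel G G" ?F by (rule N)
  have const: "h a = h b"
    if "a \<in> carrier ?F" "b \<in> carrier ?F"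
       "tensor_kernel G G #>\<^bsub>?F\<^esub> a = tensor_kernel G G #>\<^bsub>?F\<^esub> b" for a b
  proof -
    have "a \<in> tensor_kernel G G #>\<^bsub>?F\<^esub> b"
      using that F.rcos_self N.subgroup_axioms by metis
    then obtain k where k: "k \<in> tensor_kernel G G" "a = k \<otimes>\<^bsub>?F\<^esub> b"
      unfolding r_coset_def by auto
    moreover have "k \<in> carrier ?F" using k(1) N.subset by blast
    ultimately show ?thesis
      using that(2) ker by (metis G.l_one h.hom_closed h.hom_mult)
  qed
  obtain \<mu> where \<mu>: "\<mu> \<in> hom (?F Mod tensor_kernel G G) G"
    and \<mu>_coset: "\<And>a. a \<in> carrier ?F \<Longrightarrow> \<mu> (tensor_kernel G G #>\<^bsub>?F\<^esub> a) = h a"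
    using FactGroup_universal[OF h N const] by blast
  show thesis
  proof
    show "\<mu> \<in> multiplications G"
      using \<mu> by (simp add: multiplications_def tensor_product_def)
    show "ring_product G \<mu> x y = m x y" if "x \<in> carrier G" "y \<in> carrier G" for x y
      using that by (simp add: ring_product_def pure_tensor_def \<mu>_coset h_frag)
  qed
qed

lemma absolute_ideal_carrier:
  assumes "comm_group G"
  shows "absolute_ideal G (carrier G)"
  using assms comm_group.axioms(2)[OF assms] ring_product_biadditive(1)[OF assms]
  by (auto simp: absolute_ideal_def ideal_in_ring_on_def group.subgroup_self)

lemma principal_AI_least:
  assumes "comm_group G" "g \<in> carrier G"
  shows "absolute_ideal G (principal_AI G g)" "g \<in> principal_AI G g"
    and "\<And>I. \<lbrakk>absolute_ideal G I; g \<in> I\<rbrakk> \<Longrightarrow> principal_AI G g \<subseteq> I"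
proof -
  have "subgroup (principal_AI G g) G"
    unfolding principal_AI_def
    using assms absolute_ideal_carrier[OF assms(1)] comm_group.axioms(2)[OF assms(1)]
    by (intro group.subgroups_Inter) (auto simp: absolute_ideal_def)
  then show "absolute_ideal G (principal_AI G g)"
    unfolding absolute_ideal_def ideal_in_ring_on_def principal_AI_def by auto
qed (auto simp: principal_AI_def)

end

theory Submission
  imports Defs
begin

text \<open>
  Additive notation is used in all comments: \<open>a + b\<close> and \<open>n a\<close> are \<open>a \<otimes> b\<close> and \<open>a [^] n\<close>.

  Let \<open>G\<close> be quotient divisible of torsion-free rank 1. Comparing ranks, the free subgroup in the
  definition is infinite cyclic, generated by some \<open>x\<close>. Divisibility of \<open>G / \<langle>x\<rangle>\<close> says that
  \<open>G = \<langle>x\<rangle> + n G\<close> for every \<open>n \<noteq> 0\<close>, and torsion of \<open>G / \<langle>x\<rangle>\<close> says that every \<open>a\<close> has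
  \<open>n a \<in> \<langle>x\<rangle>\<close> for some \<open>n \<noteq> 0\<close>. These facts, together with the absence of nonzero divisible
  torsion subgroups, are the axioms of the locale \<open>rank_one_quotient_divisible\<close>.

  The subgroups \<open>G(char g)\<close> and \<open>T \<inter> G(char g)\<close> are invariant under endomorphisms. A one-sided
  multiplication by a fixed element is an endomorphism, so they are absolute ideals; the
  first contains \<open>g\<close>, and so does the second if \<open>g \<in> T\<close>. This bounds \<open>(g)\<^sub>A\<^sub>I\<close> from above.

  The reverse inclusion rests on two facts.

  \<^item> There are enough multiplications: for each \<open>h\<close> there is exactly one endomorphism \<open>\<phi>\<^sub>h\<close> with
    \<open>\<phi>\<^sub>h x = h\<close>. Uniqueness makes \<open>\<phi>\<^sub>h\<close> additive in \<open>h\<close>, so \<open>a \<times> b = \<phi>\<^sub>b a\<close> is a multiplication,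
    and every endomorphism \<open>f\<close> is right multiplication by \<open>f x\<close>. Hence an absolute ideal is
    invariant under all endomorphisms (\<open>absolute_ideal_invariant_under_endos\<close>).

  \<^item> If \<open>char g \<le> char h\<close>, then \<open>h \<in> \<langle>g\<rangle> + n G\<close> for every \<open>n \<noteq> 0\<close> (\<open>heights_imp_cong\<close>). For a
    prime power \<open>n\<close> this holds because \<open>G / n G\<close> is cyclic, so the height of \<open>g\<close> decides which
    subgroup of \<open>G / n G\<close> it generates; the Chinese remainder theorem gives the rest.

  If \<open>h\<close> is torsion, a suitable \<open>m\<close> splits \<open>G\<close> as \<open>G[m] \<oplus> m G\<close> with \<open>h \<in> G[m]\<close>; projecting a
  congruence \<open>h \<equiv> c g\<close> modulo \<open>m G\<close> to \<open>G[m]\<close> makes \<open>h\<close> a multiple of the image of \<open>g\<close> under an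
  endomorphism (\<open>torsion_is_multiple_of_image\<close>). If \<open>g\<close> is not torsion, some endomorphism takes
  \<open>g\<close> to an element that differs from \<open>h\<close> by torsion, and the torsion case applies to the
  difference (\<open>mem_absolute_ideal\<close>).

  The splittings \<open>G = G[m] \<oplus> m G\<close> also carry the first fact. They exist because a nonzero
  \<open>p\<close>-component of the torsion part is bounded and has a \<open>p\<close>-divisible complement, \<open>G / p G\<close> being
  cyclic and \<open>G\<close> without divisible torsion subgroups (\<open>prime_fitting\<close>).
\<close>

section \<open>Congruence modulo the multiples of an integer\<close>

context comm_group
begin

text \<open>
  Reducing to congruences lets the proofs calculate in the quotients \<open>G / n G\<close> without forming
  them.
\<close>

definition cong_mod :: "int \<Rightarrow> 'a \<Rightarrow> 'a \<Rightarrow> bool" where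
  "cong_mod n a b \<longleftrightarrow> a \<in> carrier G \<and> b \<in> carrier G \<and> (\<exists>w\<in>carrier G. a = b \<otimes> w [^] n)"

lemma cong_modI:
  "\<lbrakk>b \<in> carrier G; w \<in> carrier G; a = b \<otimes> w [^] n\<rbrakk> \<Longrightarrow> cong_mod n a b"
  unfolding cong_mod_def by auto

lemma cong_modE:
  assumes "cong_mod n a b"
  obtains w where "a \<in> carrier G" "b \<in> carrier G" "w \<in> carrier G" "a = b \<otimes> w [^] n"
  using assms unfolding cong_mod_def by auto

lemma cong_mod_refl: "a \<in> carrier G \<Longrightarrow> cong_mod n a a"
  by (rule cong_modI[of _ \<one>]) auto

lemma cong_mod_sym:
  assumes "cong_mod n a b" shows "cong_mod n b a"
  using assms
proof (rule cong_modE)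
  fix w assume "a \<in> carrier G" "b \<in> carrier G" "w \<in> carrier G" "a = b \<otimes> w [^] n"
  then show ?thesis
    by (intro cong_modI[of _ "inv w"]) (auto simp: int_pow_inv m_assoc)
qed

lemma cong_mod_trans:
  assumes "cong_mod n a b" "cong_mod n b c" shows "cong_mod n a c"
proof -
  obtain v w where "v \<in> carrier G" "a = b \<otimes> v [^] n" "c \<in> carrier G" "w \<in> carrier G" "b = c \<otimes> w [^] n"
    using assms by (meson cong_modE)
  then show ?thesis
    by (intro cong_modI[of _ "w \<otimes> v"]) (auto simp: int_pow_distrib m_assoc)
qed

lemma cong_mod_mult:
  assumes "cong_mod n a b" "cong_mod n c d" shows "cong_mod n (a \<otimes> c) (b \<otimes> d)"
proof -
  obtain v w where "b \<in> carrier G" "v \<in> carrier G" "a = b \<otimes> v [^] n"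
      "d \<in> carrier G" "w \<in> carrier G" "c = d \<otimes> w [^] n"
    using assms by (meson cong_modE)
  then show ?thesis
    by (intro cong_modI[of _ "v \<otimes> w"]) (auto simp: int_pow_distrib m_ac)
qed

lemma cong_mod_pow_scale:
  fixes k :: int
  assumes "cong_mod n a b" shows "cong_mod (n * k) (a [^] k) (b [^] k)"
proof -
  obtain w where "b \<in> carrier G" "w \<in> carrier G" "a = b \<otimes> w [^] n"
    using assms by (meson cong_modE)
  then show ?thesis
    by (intro cong_modI[of _ w]) (auto simp: int_pow_distrib int_pow_pow)
qed

lemma cong_mod_dvd:
  assumes "cong_mod n a b" "m dvd n" shows "cong_mod m a b"
proof -
  obtain w where "b \<in> carrier G" "w \<in> carrier G" "a = b \<otimes> w [^] n"
    using assms by (meson cong_modE)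
  moreover obtain k where "n = m * k" using assms by auto
  ultimately show ?thesis
    by (intro cong_modI[of _ "w [^] k"]) (auto simp: int_pow_pow mult.commute)
qed

lemma cong_mod_pow:
  fixes k :: int
  assumes "cong_mod n a b" shows "cong_mod n (a [^] k) (b [^] k)"
  using cong_mod_dvd[OF cong_mod_pow_scale[OF assms]] by simp

lemma cong_mod_inv:
  assumes "cong_mod n a b" shows "cong_mod n (inv a) (inv b)"
proof -
  have "a \<in> carrier G" "b \<in> carrier G" using assms by (auto simp: cong_mod_def)
  then show ?thesis
    using cong_mod_pow[OF assms, of "-1"] by (simp add: int_pow_neg)
qed

lemma cong_mod_one_iff:
  "cong_mod n a \<one> \<longleftrightarrow> (\<exists>w\<in>carrier G. a = w [^] n)"
  unfolding cong_mod_def by auto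

lemma cong_mod_div_iff:
  assumes "a \<in> carrier G" "b \<in> carrier G"
  shows "cong_mod n (a \<otimes> inv b) \<one> \<longleftrightarrow> cong_mod n a b"
proof
  assume "cong_mod n (a \<otimes> inv b) \<one>"
  from cong_mod_mult[OF this cong_mod_refl[OF assms(2)]] show "cong_mod n a b"
    using assms by (simp add: m_assoc)
next
  assume "cong_mod n a b"
  from cong_mod_mult[OF this cong_mod_refl[OF inv_closed[OF assms(2)]]]
  show "cong_mod n (a \<otimes> inv b) \<one>" using assms by simp
qed

lemma cong_mod_hom:
  assumes "f \<in> hom G G" "cong_mod n a b" shows "cong_mod n (f a) (f b)"
proof -
  obtain w where "b \<in> carrier G" "w \<in> carrier G" "a = b \<otimes> w [^] n"
    using assms by (meson cong_modE)
  then show ?thesis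
    using assms(1)
    by (intro cong_modI[of _ "f w"])
       (auto simp: hom_in_carrier hom_mult hom_int_pow[OF assms(1) _ is_group is_group])
qed

lemma pow_eq_one_mult:
  fixes k l :: int
  assumes "a \<in> carrier G" "a [^] k = \<one>" shows "a [^] (k * l) = \<one>"
  using assms by (metis int_pow_one int_pow_pow)

lemma eq_if_div_eq_one:
  assumes "a \<in> carrier G" "b \<in> carrier G" "a \<otimes> inv b = \<one>" shows "a = b"
proof -
  have "a = a \<otimes> inv b \<otimes> b" using assms(1,2) by (simp add: m_assoc)
  then show ?thesis using assms by simp
qed

lemma cong_mod_crt:
  assumes "cong_mod m h (g [^] (a::int))" "cong_mod n h (g [^] (b::int))" "coprime m n" "g \<in> carrier G"
  shows "\<exists>c::int. cong_mod (m * n) h (g [^] c)"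
proof -
  have h: "h \<in> carrier G" using assms by (simp add: cong_mod_def)
  obtain u v where uv: "u * m + v * n = 1" using bezout_int[of m n] assms by auto
  have "cong_mod (m * n) ((h [^] n) [^] v) (((g [^] a) [^] n) [^] v)"
    by (intro cong_mod_pow cong_mod_pow_scale assms)
  moreover have "cong_mod (m * n) ((h [^] m) [^] u) (((g [^] b) [^] m) [^] u)"
    using cong_mod_pow[OF cong_mod_pow_scale[OF assms(2), of m]] by (simp add: mult.commute)
  ultimately have "cong_mod (m * n) ((h [^] m) [^] u \<otimes> (h [^] n) [^] v)
      (((g [^] b) [^] m) [^] u \<otimes> ((g [^] a) [^] n) [^] v)" by (rule cong_mod_mult[rotated])
  moreover have "(h [^] m) [^] u \<otimes> (h [^] n) [^] v = h"
    using h uv by (simp add: int_pow_pow int_pow_mult[symmetric] mult.commute)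
  ultimately show ?thesis using assms(4) by (auto simp: int_pow_pow int_pow_mult[symmetric])
qed

section \<open>Heights, torsion, and invariant subgroups\<close>

text \<open>
  Being divisible by \<open>p\<^sup>k\<close> is downward closed in \<open>k\<close>, so the supremum in the height is attained
  whenever it is finite, and is approached otherwise.
\<close>

lemma le_height_iff:
  assumes a: "a \<in> carrier G"
  shows "enat k \<le> height G p a \<longleftrightarrow> cong_mod (int p ^ k) a \<one>"
proof -
  let ?S = "{enat l | l. \<exists>y\<in>carrier G. y [^] (p ^ l) = a}"
  have conv: "cong_mod (int p ^ l) a \<one> \<longleftrightarrow> (\<exists>y\<in>carrier G. y [^] (p ^ l) = a)" for l
    unfolding cong_mod_one_iff by (metis int_pow_int of_nat_power)
  show ?thesis
  proof
    assume "cong_mod (int p ^ k) a \<one>"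
    then have "enat k \<in> ?S" using conv by blast
    then show "enat k \<le> height G p a" unfolding height_def by (rule Sup_upper)
  next
    assume le: "enat k \<le> height G p a"
    show "cong_mod (int p ^ k) a \<one>"
    proof (rule ccontr)
      assume not: "\<not> cong_mod (int p ^ k) a \<one>"
      have small: "l < k" if "\<exists>y\<in>carrier G. y [^] (p ^ l) = a" for l
      proof (rule ccontr)
        assume "\<not> l < k"
        then have "cong_mod (int p ^ k) a \<one>"
          using cong_mod_dvd[of "int p ^ l" a \<one> "int p ^ k"] that conv by (simp add: le_imp_power_dvd)
        then show False using not by blast
      qed
      have "0 < k" using small[of 0] a by auto
      have "height G p a \<le> enat (k - 1)"
        unfolding height_def
      proof (rule Sup_least)
        fix e assume "e \<in> ?S"
        then obtain l where "e = enat l" "\<exists>y\<in>carrier G. y [^] (p ^ l) = a" by blast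
        then show "e \<le> enat (k - 1)" using small[of l] by simp
      qed
      then show False using le \<open>0 < k\<close> by (metis diff_less enat_ord_simps(1) leD less_one order_trans)
    qed
  qed
qed

lemma char_le_iff:
  assumes a: "a \<in> carrier G" and b: "b \<in> carrier G"
  shows "char_le (characteristic G a) (characteristic G b) \<longleftrightarrow>
    (\<forall>p k. Factorial_Ring.prime (p::nat) \<longrightarrow> cong_mod (int p ^ k) a \<one> \<longrightarrow> cong_mod (int p ^ k) b \<one>)"
proof -
  have "height G p a \<le> height G p b \<longleftrightarrow>
      (\<forall>k. cong_mod (int p ^ k) a \<one> \<longrightarrow> cong_mod (int p ^ k) b \<one>)" for p
  proof
    assume "height G p a \<le> height G p b"
    then show "\<forall>k. cong_mod (int p ^ k) a \<one> \<longrightarrow> cong_mod (int p ^ k) b \<one>"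
      using le_height_iff[OF a] le_height_iff[OF b] order_trans by blast
  next
    assume H: "\<forall>k. cong_mod (int p ^ k) a \<one> \<longrightarrow> cong_mod (int p ^ k) b \<one>"
    show "height G p a \<le> height G p b"
      unfolding height_def[of G p a]
    proof (rule Sup_least)
      fix e assume "e \<in> {enat l | l. \<exists>y\<in>carrier G. y [^] (p ^ l) = a}"
      then obtain l where l: "e = enat l" "\<exists>y\<in>carrier G. y [^] (p ^ l) = a" by blast
      have "enat l \<le> height G p a" unfolding height_def using l by (intro Sup_upper) blast
      then show "e \<le> height G p b"
        unfolding l(1) using le_height_iff[OF a] le_height_iff[OF b] H by blast
    qed
  qed
  then show ?thesis by (simp add: char_le_def characteristic_def)
qed

lemma char_subgroup_characteristic:
  assumes g: "g \<in> carrier G"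
  shows "subgroup (char_subgroup G (characteristic G g)) G"
    and "\<lbrakk>f \<in> hom G G; a \<in> char_subgroup G (characteristic G g)\<rbrakk>
      \<Longrightarrow> f a \<in> char_subgroup G (characteristic G g)"
    and "g \<in> char_subgroup G (characteristic G g)"
proof -
  let ?C = "char_subgroup G (characteristic G g)"
  have mem: "a \<in> ?C \<longleftrightarrow> a \<in> carrier G \<and> (\<forall>p k. Factorial_Ring.prime (p::nat) \<longrightarrow>
      cong_mod (int p ^ k) g \<one> \<longrightarrow> cong_mod (int p ^ k) a \<one>)" for a
    unfolding char_subgroup_def using char_le_iff[OF g] by blast
  show g_in: "g \<in> ?C" using g by (auto simp: mem)
  show "subgroup ?C G"
  proof (rule subgroupI)
    show "?C \<noteq> {}" using g_in by blast
  next
    fix a assume "a \<in> ?C"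
    then show "inv a \<in> ?C" unfolding mem using cong_mod_inv[of _ a \<one>] by auto
  next
    fix a b assume "a \<in> ?C" "b \<in> ?C"
    then show "a \<otimes> b \<in> ?C" unfolding mem using cong_mod_mult[of _ a \<one> b \<one>] by auto
  qed (auto simp: mem)
  show "f a \<in> ?C" if f: "f \<in> hom G G" and "a \<in> ?C"
  proof -
    have "f \<one> = \<one>" using f hom_one is_group by blast
    then show ?thesis
      using that cong_mod_hom[OF f, of _ a \<one>] hom_in_carrier[OF f, of a] unfolding mem by auto
  qed
qed

lemma torsion_part_iff:
  "a \<in> torsion_part G \<longleftrightarrow> a \<in> carrier G \<and> (\<exists>n::int. n \<noteq> 0 \<and> a [^] n = \<one>)"
proof -
  have "\<exists>n::nat. 0 < n \<and> a [^] n = \<one>" if "a \<in> carrier G" "n \<noteq> 0" "a [^] n = \<one>" for n :: int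
  proof -
    have "a [^] int (nat \<bar>n\<bar>) = \<one>" using that by (auto simp: abs_if int_pow_neg)
    then show ?thesis using that by (intro exI[of _ "nat \<bar>n\<bar>"]) (simp add: int_pow_int)
  qed
  moreover have "\<exists>n::int. n \<noteq> 0 \<and> a [^] n = \<one>" if "0 < n" "a [^] n = \<one>" for n :: nat
    using that by (intro exI[of _ "int n"]) (simp add: int_pow_int)
  ultimately show ?thesis unfolding torsion_part_def by blast
qed

lemma subgroup_torsion_part: "subgroup (torsion_part G) G"
proof (rule subgroupI)
  have "\<one> \<in> torsion_part G" unfolding torsion_part_iff by (auto intro!: exI[of _ 1])
  then show "torsion_part G \<noteq> {}" by blast
next
  fix a assume "a \<in> torsion_part G" then show "inv a \<in> torsion_part G"
    unfolding torsion_part_iff by (auto simp: int_pow_inv)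
next
  fix a b assume "a \<in> torsion_part G" "b \<in> torsion_part G"
  then obtain m n :: int where ab: "a \<in> carrier G" "m \<noteq> 0" "a [^] m = \<one>" "b \<in> carrier G" "n \<noteq> 0" "b [^] n = \<one>"
    unfolding torsion_part_iff by blast
  then have "(a \<otimes> b) [^] (m * n) = \<one>"
    using pow_eq_one_mult[of a m n] pow_eq_one_mult[of b n m]
    by (simp add: int_pow_distrib mult.commute)
  then show "a \<otimes> b \<in> torsion_part G" unfolding torsion_part_iff using ab by (auto intro!: exI[of _ "m * n"])
qed (auto simp: torsion_part_iff)

lemma torsion_part_invariant:
  assumes f: "f \<in> hom G G" and a: "a \<in> torsion_part G"
  shows "f a \<in> torsion_part G"
proof -
  obtain n :: int where n: "a \<in> carrier G" "n \<noteq> 0" "a [^] n = \<one>" using a unfolding torsion_part_iff by blast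
  have "f a [^] n = f \<one>" using n hom_int_pow[OF f n(1) is_group is_group, of n] by simp
  also have "\<dots> = \<one>" using f hom_one is_group by blast
  finally show ?thesis unfolding torsion_part_iff using n hom_in_carrier[OF f] by blast
qed

text \<open>
  The torsion part is pure: a root of a torsion element is torsion. So heights in it agree with
  heights in the whole group.
\<close>

lemma char_subgroup_torsion_part:
  "char_subgroup (G\<lparr>carrier := torsion_part G\<rparr>) \<chi> = torsion_part G \<inter> char_subgroup G \<chi>"
proof -
  let ?T = "G\<lparr>carrier := torsion_part G\<rparr>"
  have T: "a \<in> carrier G" if "a \<in> torsion_part G" for a using that by (simp add: torsion_part_def)
  have root: "y \<in> torsion_part G"
    if a: "y [^] (p ^ k) \<in> torsion_part G" and y: "y \<in> carrier G" "Factorial_Ring.prime p" for y and p k :: nat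
  proof -
    obtain n where n: "0 < n" "(y [^] (p ^ k)) [^] (n::nat) = \<one>" using a by (auto simp: torsion_part_def)
    then have "y [^] (p ^ k * n) = \<one>" using y by (simp add: nat_pow_pow)
    moreover have "0 < p ^ k * n" using n y(2) by (simp add: prime_gt_0_nat)
    ultimately show ?thesis using y(1) unfolding torsion_part_def by blast
  qed
  have "height ?T p a = height G p a" if a: "a \<in> torsion_part G" and p: "Factorial_Ring.prime p" for a p
  proof -
    have "(\<exists>y\<in>carrier ?T. y [^]\<^bsub>?T\<^esub> (p ^ k) = a) \<longleftrightarrow> (\<exists>y\<in>carrier G. y [^] (p ^ k) = a)" for k
      unfolding nat_pow_consistent[symmetric] using root[OF _ _ p] T a by fastforce
    then show ?thesis unfolding height_def by presburger
  qed
  then have "char_le \<chi> (characteristic ?T a) \<longleftrightarrow> char_le \<chi> (characteristic G a)"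
    if "a \<in> torsion_part G" for a
    using that unfolding char_le_def characteristic_def by metis
  then show ?thesis using T unfolding char_subgroup_def by auto
qed

text \<open>
  Fixing one factor of a multiplication gives an endomorphism.
\<close>

lemma absolute_ideal_if_invariant:
  assumes I: "subgroup I G" and inv: "\<And>f a. \<lbrakk>f \<in> hom G G; a \<in> I\<rbrakk> \<Longrightarrow> f a \<in> I"
  shows "absolute_ideal G I"
  unfolding absolute_ideal_def ideal_in_ring_on_def
proof (intro conjI ballI I)
  fix \<mu> a y assume \<mu>: "\<mu> \<in> multiplications G" and a: "a \<in> I" and y: "y \<in> carrier G"
  note bi = ring_product_biadditive[OF comm_group_axioms \<mu>]
  have "(\<lambda>a. ring_product G \<mu> a y) \<in> hom G G" "(\<lambda>a. ring_product G \<mu> y a) \<in> hom G G"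
    unfolding hom_def using bi y by auto
  from inv[OF this(1) a] inv[OF this(2) a]
  show "ring_product G \<mu> a y \<in> I" "ring_product G \<mu> y a \<in> I" .
qed

section \<open>Fitting decompositions\<close>

text \<open>
  As in Fitting's lemma, the two conditions say that multiplication by \<open>n\<close> has the same kernel and
  the same image as its square. They are equivalent to the splitting \<open>G = G[n] \<oplus> n G\<close>.
\<close>

definition fitting :: "int \<Rightarrow> bool" where
  "fitting n \<longleftrightarrow> n \<noteq> 0 \<and> (\<forall>u\<in>carrier G. u [^] (n * n) = \<one> \<longrightarrow> u [^] n = \<one>) \<and>
     (\<forall>u\<in>carrier G. \<exists>w\<in>carrier G. u [^] n = w [^] (n * n))"

text \<open>
  Closure under products lets a splitting for a composite order be assembled one prime at a time.
\<close>

lemma fitting_mult: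
  assumes "fitting m" "fitting n" shows "fitting (m * n)"
  unfolding fitting_def
proof (intro conjI ballI impI)
  show "m * n \<noteq> 0" using assms by (auto simp: fitting_def)
next
  fix u assume u: "u \<in> carrier G" "u [^] (m * n * (m * n)) = \<one>"
  then have "(u [^] (n * n)) [^] (m * m) = \<one>" by (simp add: int_pow_pow ac_simps)
  then have "(u [^] (n * n)) [^] m = \<one>" using assms u by (auto simp: fitting_def)
  then have "(u [^] m) [^] (n * n) = \<one>" using u by (simp add: int_pow_pow ac_simps)
  then have "(u [^] m) [^] n = \<one>" using assms u by (auto simp: fitting_def)
  then show "u [^] (m * n) = \<one>" using u by (simp add: int_pow_pow)
next
  fix u assume u: "u \<in> carrier G"
  obtain v where v: "v \<in> carrier G" "u [^] n = v [^] (n * n)"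
    using assms u by (auto simp: fitting_def)
  obtain w where w: "w \<in> carrier G" "v [^] m = w [^] (m * m)"
    using assms v by (auto simp: fitting_def)
  have "u [^] (m * n) = (v [^] m) [^] (n * n)"
    using u v by (metis int_pow_pow mult.commute)
  also have "\<dots> = w [^] (m * n * (m * n))" using w by (simp add: int_pow_pow ac_simps)
  finally show "\<exists>w\<in>carrier G. u [^] (m * n) = w [^] (m * n * (m * n))" using w by blast
qed

lemma fitting_1: "fitting 1"
  by (auto simp: fitting_def)

lemma fitting_disjoint:
  assumes "fitting m" "u [^] m = \<one>" "cong_mod m u \<one>" "u \<in> carrier G"
  shows "u = \<one>"
proof -
  obtain w where w: "w \<in> carrier G" "u = w [^] m" using assms by (auto simp: cong_mod_one_iff)
  then have "w [^] (m * m) = \<one>" using assms by (simp add: int_pow_pow)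
  then show ?thesis using assms w by (auto simp: fitting_def)
qed

lemma fitting_split:
  assumes "fitting m" "a \<in> carrier G"
  obtains b where "b \<in> carrier G" "b [^] m = \<one>" "cong_mod m a b"
proof -
  obtain w where w: "w \<in> carrier G" "a [^] m = w [^] (m * m)"
    using assms by (auto simp: fitting_def)
  let ?b = "a \<otimes> inv (w [^] m)"
  have "?b [^] m = \<one>" using w assms by (simp add: int_pow_distrib int_pow_inv int_pow_pow)
  moreover have "cong_mod m a ?b" using w assms by (intro cong_modI[of _ w]) (auto simp: m_assoc)
  ultimately show ?thesis using that[of ?b] assms w by simp
qed

end

section \<open>Reduced groups approximated by one element\<close>

text \<open>
  The element \<open>x\<close> generates a free subgroup whose quotient is torsion and divisible. Here
  \<open>x_generates_mod\<close> is the divisibility of that quotient.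
\<close>

locale rank_one_quotient_divisible = comm_group G for G (structure) +
  fixes x
  assumes x_closed [simp]: "x \<in> carrier G"
    and x_infinite_order: "x [^] (k::int) = \<one> \<Longrightarrow> k = 0"
    and torsion_over_x: "a \<in> carrier G \<Longrightarrow> \<exists>(n::int) (k::int). n \<noteq> 0 \<and> a [^] n = x [^] k"
    and x_generates_mod: "\<lbrakk>a \<in> carrier G; n \<noteq> 0\<rbrakk> \<Longrightarrow> \<exists>j::int. cong_mod n a (x [^] j)"
    and reduced: "\<lbrakk>subgroup D G; divisible_group (G\<lparr>carrier := D\<rparr>); torsion_group (G\<lparr>carrier := D\<rparr>)\<rbrakk>
       \<Longrightarrow> D = {\<one>}"
begin

text \<open>
  A \<open>p\<close>-group is uniquely divisible by every integer prime to \<open>p\<close>, so \<open>p\<close>-divisibility already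
  makes it divisible.
\<close>

lemma p_divisible_p_torsion_trivial:
  fixes p :: nat
  assumes D: "subgroup D G" and p: "Factorial_Ring.prime p"
    and tors: "\<And>d. d \<in> D \<Longrightarrow> \<exists>k::nat. d [^] (int p ^ k) = \<one>"
    and div: "\<And>d. d \<in> D \<Longrightarrow> \<exists>e\<in>D. e [^] int p = d"
  shows "D = {\<one>}"
proof (rule reduced[OF D])
  have Dc: "d \<in> carrier G" if "d \<in> D" for d using D that by (rule subgroup.mem_carrier)
  have root: "\<exists>e\<in>D. e [^] (int p ^ a) = d" if "d \<in> D" for a :: nat and d
    using that
  proof (induction a arbitrary: d)
    case (Suc a)
    then obtain e where e: "e \<in> D" "e [^] (int p ^ a) = d" by blast
    obtain e' where e': "e' \<in> D" "e' [^] int p = e" using div[OF e(1)] by blast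
    have "e' [^] (int p ^ Suc a) = d"
      using e e' by (metis Dc int_pow_pow power_Suc)
    then show ?case using e' by blast
  qed (auto simp: Dc)
  show "divisible_group (G\<lparr>carrier := D\<rparr>)"
    unfolding divisible_group_def
  proof (intro allI impI ballI)
    fix n :: nat and d assume n: "0 < n" and d: "d \<in> carrier (G\<lparr>carrier := D\<rparr>)"
    obtain q where q: "n = p ^ multiplicity p n * q" "\<not> p dvd q"
      using n p multiplicity_decompose'[of n p] by (metis neq0_conv not_prime_unit)
    let ?a = "multiplicity p n"
    obtain e where e: "e \<in> D" "e [^] (int p ^ ?a) = d" using root d by auto
    obtain k where k: "e [^] (int p ^ k) = \<one>" using tors e by blast
    have "coprime (int q) (int p ^ k)"
      using p q(2) by (metis coprime_commute coprime_int_iff coprime_power_right_iff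
          of_nat_power prime_imp_coprime)
    then obtain u v where uv: "u * int q + v * int p ^ k = 1"
      using bezout_int[of "int q" "int p ^ k"] by auto
    have "e [^] (u * int q) = e [^] (u * int q + v * int p ^ k)"
      using k Dc[OF e(1)] by (simp add: int_pow_mult pow_eq_one_mult mult.commute[of v])
    then have eu: "e [^] (u * int q) = e" using uv Dc e by simp
    have "(e [^] u) [^] int n = (e [^] (u * int q)) [^] (int p ^ ?a)"
      using Dc[OF e(1)] by (subst q(1)) (simp add: int_pow_pow ac_simps)
    also have "\<dots> = d" using eu e by simp
    finally have "(e [^] u) [^] n = d" by (simp add: int_pow_int)
    moreover have "e [^] u \<in> D" using D e by (simp add: subgroup_int_pow_closed)
    ultimately show "\<exists>y\<in>carrier (G\<lparr>carrier := D\<rparr>). y [^]\<^bsub>G\<lparr>carrier := D\<rparr>\<^esub> n = d"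
      using nat_pow_consistent by auto
  qed
  have "\<exists>n>0. d [^] (n::nat) = \<one>" if d: "d \<in> D" for d
  proof -
    obtain k where "d [^] (int p ^ k) = \<one>" using tors d by blast
    then have "d [^] (p ^ k) = \<one>" by (metis int_pow_int of_nat_power)
    then show ?thesis using p by (metis prime_gt_0_nat zero_less_power)
  qed
  then show "torsion_group (G\<lparr>carrier := D\<rparr>)"
    unfolding torsion_group_def torsion_part_def using nat_pow_consistent by auto
qed

definition p_part :: "nat \<Rightarrow> 'a set" where
  "p_part p = {u \<in> carrier G. \<exists>k::nat. u [^] (int p ^ k) = \<one>}"

lemma p_part_pow_cancel:
  assumes "u \<in> carrier G" "u [^] (int p ^ a) \<in> p_part p"
  shows "u \<in> p_part p"
proof -
  obtain k where "(u [^] (int p ^ a)) [^] (int p ^ k) = \<one>" using assms by (auto simp: p_part_def)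
  then have "u [^] (int p ^ (a + k)) = \<one>" using assms by (simp add: int_pow_pow power_add)
  then show ?thesis using assms by (auto simp: p_part_def)
qed

lemma subgroup_p_part: "subgroup (p_part p) G"
proof (rule subgroupI)
  show "p_part p \<noteq> {}"
  proof -
    have "\<one> \<in> p_part p" by (simp add: p_part_def)
    then show ?thesis by blast
  qed
next
  fix a assume "a \<in> p_part p" then show "inv a \<in> p_part p"
    by (auto simp: p_part_def int_pow_inv)
next
  fix a b assume "a \<in> p_part p" "b \<in> p_part p"
  then obtain k l where kl: "a \<in> carrier G" "a [^] (int p ^ k) = \<one>" "b \<in> carrier G" "b [^] (int p ^ l) = \<one>"
    by (auto simp: p_part_def)
  have "(a \<otimes> b) [^] (int p ^ (k + l)) = \<one>"
    using kl pow_eq_one_mult[OF kl(1,2), of "int p ^ l"] pow_eq_one_mult[OF kl(3,4), of "int p ^ k"]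
    by (simp add: int_pow_distrib power_add mult.commute)
  then show "a \<otimes> b \<in> p_part p" using kl by (auto simp: p_part_def)
qed (auto simp: p_part_def)

text \<open>
  If the \<open>p\<close>-component \<open>T\<close> of the torsion part satisfies \<open>T = p T\<close>, it vanishes. Otherwise choose
  \<open>s \<in> T\<close> that is not in \<open>p T\<close>, hence not in \<open>p G\<close>. As \<open>G / p G\<close> is cyclic of order at most \<open>p\<close>,
  \<open>s\<close> generates it: \<open>G = \<langle>s\<rangle> + p G\<close>. Multiplying by a power \<open>p\<^sup>m\<close> that kills \<open>s\<close> gives
  \<open>p\<^sup>m G = p\<^bsup>m+1\<^esup> G\<close>, whence \<open>p\<^sup>m T\<close> is \<open>p\<close>-divisible and so zero.
\<close>

lemma prime_fitting:
  assumes p: "Factorial_Ring.prime (p::nat)"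
  shows "\<exists>m. fitting m \<and> (\<forall>u\<in>carrier G. u [^] int p = \<one> \<longrightarrow> u [^] m = \<one>)"
proof (cases "\<forall>s\<in>p_part p. \<exists>e\<in>p_part p. e [^] int p = s")
  case True
  then have "p_part p = {\<one>}"
    using p by (intro p_divisible_p_torsion_trivial[OF subgroup_p_part p]) (auto simp: p_part_def)
  moreover have "u \<in> p_part p" if "u \<in> carrier G" "u [^] int p = \<one>" for u
    using that unfolding p_part_def by (auto intro!: exI[of _ 1])
  ultimately show ?thesis using fitting_1 by (intro exI[of _ 1]) auto
next
  case False
  then obtain s where s: "s \<in> p_part p" and no_root: "\<And>e. e \<in> p_part p \<Longrightarrow> e [^] int p \<noteq> s"
    by blast
  have sc: "s \<in> carrier G" using s by (simp add: p_part_def)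
  have s_nroot: "w [^] int p \<noteq> s" if "w \<in> carrier G" for w
    using no_root[of w] p_part_pow_cancel[of w p 1] that s by auto
  obtain m where m: "s [^] (int p ^ m) = \<one>" using s by (auto simp: p_part_def)
  have p0: "int p \<noteq> 0" using p by auto
  obtain j :: int where j: "cong_mod (int p) s (x [^] j)" using x_generates_mod[OF sc p0] by blast
  have "\<not> int p dvd j"
  proof
    assume "int p dvd j"
    then obtain l where l: "j = int p * l" by auto
    then have "cong_mod (int p) (x [^] j) \<one>"
      unfolding cong_mod_one_iff by (intro bexI[of _ "x [^] l"]) (auto simp: int_pow_pow mult.commute)
    then have "cong_mod (int p) s \<one>" using cong_mod_trans j by blast
    then show False using s_nroot by (auto simp: cong_mod_one_iff)
  qed
  then have "coprime j (int p)" using p by (metis coprime_commute prime_imp_coprime prime_nat_int_transfer)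
  then obtain u v where uv: "u * j + v * int p = 1" using bezout_int[of j "int p"] by auto
  have "x = x [^] (u * j + v * int p)" using uv by simp
  also have "\<dots> = x [^] (j * u) \<otimes> (x [^] v) [^] int p" by (simp add: int_pow_mult int_pow_pow mult.commute)
  finally have "cong_mod (int p) x (x [^] (j * u))" by (intro cong_modI) auto
  moreover have "cong_mod (int p) (x [^] (j * u)) (s [^] u)"
    using cong_mod_pow[OF cong_mod_sym[OF j], of u] by (simp add: int_pow_pow)
  ultimately have xs: "cong_mod (int p) x (s [^] u)" using cong_mod_trans by blast
  have step: "\<exists>w\<in>carrier G. a [^] (int p ^ m) = w [^] (int p ^ Suc m)" if a: "a \<in> carrier G" for a
  proof -
    obtain i :: int where i: "cong_mod (int p) a (x [^] i)" using x_generates_mod[OF a p0] by blast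
    have "cong_mod (int p) a ((s [^] u) [^] i)"
      using i cong_mod_pow[OF xs] cong_mod_trans by blast
    from cong_mod_pow_scale[OF this, of "int p ^ m"]
    have "cong_mod (int p ^ Suc m) (a [^] (int p ^ m)) (((s [^] u) [^] i) [^] (int p ^ m))" by simp
    moreover have "((s [^] u) [^] i) [^] (int p ^ m) = (s [^] (int p ^ m)) [^] (u * i)"
      using sc by (simp add: int_pow_pow ac_simps)
    ultimately show ?thesis using m by (simp add: cong_mod_one_iff)
  qed
  have steps: "\<exists>w\<in>carrier G. a [^] (int p ^ m) = w [^] (int p ^ (m + k))" if a: "a \<in> carrier G" for a and k :: nat
  proof (induction k)
    case (Suc k)
    then obtain w where w: "w \<in> carrier G" "a [^] (int p ^ m) = w [^] (int p ^ (m + k))" by blast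
    obtain w' where w': "w' \<in> carrier G" "w [^] (int p ^ m) = w' [^] (int p ^ Suc m)" using step[OF w(1)] by blast
    have "a [^] (int p ^ m) = (w [^] (int p ^ m)) [^] (int p ^ k)"
      using w by (simp add: int_pow_pow power_add)
    also have "\<dots> = w' [^] (int p ^ (m + Suc k))" using w' by (simp add: int_pow_pow power_add mult.assoc)
    finally show ?case using w' by blast
  qed (use a in auto)
  \<comment> \<open>This is \<open>p\<^sup>m T\<close>, which is \<open>p\<close>-divisible because \<open>p\<^sup>m T \<subseteq> p\<^bsup>m+1\<^esup> G\<close> and roots of elements of \<open>T\<close> lie in \<open>T\<close>.\<close>
  let ?D = "(\<lambda>u. u [^] (int p ^ m)) ` p_part p"
  have h: "group_hom G G (\<lambda>u. u [^] (int p ^ m))"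
    by (auto simp: group_hom_def group_hom_axioms_def hom_def int_pow_distrib is_group)
  have "?D = {\<one>}"
  proof (rule p_divisible_p_torsion_trivial[OF _ p])
    show "subgroup ?D G" using group_hom.subgroup_img_is_subgroup[OF h subgroup_p_part] .
  next
    fix d assume "d \<in> ?D"
    then obtain t where t: "t \<in> p_part p" "d = t [^] (int p ^ m)" by blast
    have tc: "t \<in> carrier G" using t by (simp add: p_part_def)
    have "d \<in> p_part p" using t subgroup_p_part by (auto intro: subgroup_int_pow_closed)
    then show "\<exists>k::nat. d [^] (int p ^ k) = \<one>" by (auto simp: p_part_def)
    obtain w where w: "w \<in> carrier G" "d = w [^] (int p ^ Suc m)" using step[OF tc] t by auto
    have "w \<in> p_part p" using p_part_pow_cancel[OF w(1)] w(2) \<open>d \<in> p_part p\<close> by blast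
    moreover have "(w [^] (int p ^ m)) [^] int p = d" using w by (simp add: int_pow_pow mult.commute)
    ultimately show "\<exists>e\<in>?D. e [^] int p = d" by blast
  qed
  then have kill: "t [^] (int p ^ m) = \<one>" if "t \<in> p_part p" for t using that by blast
  have "fitting (int p ^ m)"
    unfolding fitting_def
  proof (intro conjI ballI impI)
    fix t assume "t \<in> carrier G" "t [^] (int p ^ m * int p ^ m) = \<one>"
    then have "t \<in> p_part p" by (auto simp: p_part_def power_add[symmetric])
    then show "t [^] (int p ^ m) = \<one>" by (rule kill)
  next
    fix t assume "t \<in> carrier G"
    then show "\<exists>w\<in>carrier G. t [^] (int p ^ m) = w [^] (int p ^ m * int p ^ m)"
      using steps[of t m] by (simp add: power_add)
  qed (use p0 in auto)
  moreover have "t [^] (int p ^ m) = \<one>" if "t \<in> carrier G" "t [^] int p = \<one>" for t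
  proof (rule kill)
    show "t \<in> p_part p" using that unfolding p_part_def by (auto intro!: exI[of _ 1])
  qed
  ultimately show ?thesis by blast
qed

lemma exists_fitting_nat:
  fixes n :: nat
  assumes "n > 0"
  shows "\<exists>m. fitting m \<and> (\<forall>u\<in>carrier G. u [^] int n = \<one> \<longrightarrow> u [^] m = \<one>)"
  using assms
proof (induction n rule: prime_divisors_induct)
  case (factor p n)
  then obtain m where m: "fitting m" "\<And>u. u \<in> carrier G \<Longrightarrow> u [^] int n = \<one> \<Longrightarrow> u [^] m = \<one>"
    by auto
  obtain l where l: "fitting l" "\<And>u. u \<in> carrier G \<Longrightarrow> u [^] int p = \<one> \<Longrightarrow> u [^] l = \<one>"
    using prime_fitting[OF factor(1)] by auto
  have "u [^] (l * m) = \<one>" if u: "u \<in> carrier G" "u [^] int (p * n) = \<one>" for u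
  proof -
    have "(u [^] int n) [^] int p = \<one>" using u by (simp add: int_pow_pow mult.commute)
    then have "(u [^] int n) [^] l = \<one>" using l u by simp
    then have "(u [^] l) [^] int n = \<one>" using u by (simp add: int_pow_pow mult.commute)
    then have "(u [^] l) [^] m = \<one>" using m u by simp
    then show ?thesis using u by (simp add: int_pow_pow)
  qed
  then show ?case using fitting_mult[OF l(1) m(1)] by blast
qed (auto intro: fitting_1 exI[of _ 1])

lemma exists_fitting:
  fixes n :: int
  assumes "n \<noteq> 0"
  obtains m where "fitting m" "\<And>u. u \<in> carrier G \<Longrightarrow> u [^] n = \<one> \<Longrightarrow> u [^] m = \<one>"
proof -
  obtain m where m: "fitting m" "\<And>u. u \<in> carrier G \<Longrightarrow> u [^] int (nat \<bar>n\<bar>) = \<one> \<Longrightarrow> u [^] m = \<one>"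
    using exists_fitting_nat[of "nat \<bar>n\<bar>"] assms by auto
  have "u [^] int (nat \<bar>n\<bar>) = \<one>" if "u \<in> carrier G" "u [^] n = \<one>" for u
    using that by (auto simp: abs_if int_pow_neg)
  then show ?thesis using m that by blast
qed

text \<open>
  The first Ulm subgroup \<open>\<Inter>\<^sub>n n G\<close> is torsion-free. Equality of two elements can therefore be
  checked on one multiple by a nonzero integer and on all residues; this rule replaces an
  embedding of \<open>G\<close> into a product of cyclic and \<open>p\<close>-adic groups.
\<close>

lemma torsion_cong_imp_eq:
  assumes a: "a \<in> carrier G" and b: "b \<in> carrier G"
    and "n \<noteq> 0" "a [^] n = b [^] (n::int)" and cong: "\<And>m. m \<noteq> 0 \<Longrightarrow> cong_mod m a b"
  shows "a = b"
proof -
  obtain m where m: "fitting m" "\<And>u. u \<in> carrier G \<Longrightarrow> u [^] n = \<one> \<Longrightarrow> u [^] m = \<one>"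
    using exists_fitting assms by blast
  have "(a \<otimes> inv b) [^] n = \<one>" using assms by (simp add: int_pow_distrib int_pow_inv)
  then have "(a \<otimes> inv b) [^] m = \<one>" using m a b by simp
  moreover have "cong_mod m (a \<otimes> inv b) \<one>"
    using cong m a b by (simp add: cong_mod_div_iff fitting_def)
  ultimately have "a \<otimes> inv b = \<one>" using fitting_disjoint[OF m(1)] a b by blast
  then show ?thesis using a b by (metis eq_if_div_eq_one)
qed

section \<open>Endomorphisms\<close>

text \<open>
  The image of \<open>a\<close> has its residues, and its multiple by some nonzero integer, determined by
  the image of \<open>x\<close>.
\<close>

lemma hom_eqI:
  assumes f: "f \<in> hom G G" and f': "f' \<in> hom G G" and "f x = f' x" and a: "a \<in> carrier G"
  shows "f a = f' a"
proof -
  note pow = hom_int_pow[OF _ _ is_group is_group]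
  obtain n k where n: "n \<noteq> 0" "a [^] (n::int) = x [^] (k::int)" using torsion_over_x a by blast
  show ?thesis
  proof (rule torsion_cong_imp_eq[of _ _ n])
    show "f a [^] n = f' a [^] n"
      using assms n(2) by (metis pow x_closed)
    show "cong_mod m (f a) (f' a)" if "m \<noteq> 0" for m
    proof -
      obtain j where "cong_mod m a (x [^] (j::int))" using x_generates_mod a \<open>m \<noteq> 0\<close> by blast
      then have "cong_mod m (f a) (f x [^] j)" "cong_mod m (f' a) (f' x [^] j)"
        using cong_mod_hom[OF f, of m a] cong_mod_hom[OF f', of m a] pow[OF f x_closed] pow[OF f' x_closed]
        by metis+
      then show ?thesis using assms(3) cong_mod_trans cong_mod_sym by metis
    qed
  qed (use assms n hom_in_carrier in auto)
qed

text \<open>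
  The graph of the endomorphism that sends \<open>x\<close> to \<open>h\<close>. Since \<open>a\<close> is related to \<open>x\<close> in two ways,
  through its residues and through a multiple by a nonzero integer, its image is prescribed by
  transporting both to \<open>h\<close>. The residues miss a divisible summand of \<open>G\<close>, the multiple misses torsion.
\<close>

definition corresponds :: "'a \<Rightarrow> 'a \<Rightarrow> 'a \<Rightarrow> bool" where
  "corresponds h a c \<longleftrightarrow> c \<in> carrier G \<and>
     (\<forall>m j. m \<noteq> 0 \<longrightarrow> cong_mod m a (x [^] (j::int)) \<longrightarrow> cong_mod m c (h [^] j)) \<and>
     (\<exists>n k. n \<noteq> 0 \<and> a [^] (n::int) = x [^] (k::int) \<and> c [^] n = h [^] k)"

lemma cong_mod_exponents:
  fixes i j :: int
  assumes "h \<in> carrier G" "m \<noteq> 0" "cong_mod m (x [^] i) (x [^] j)"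
  shows "cong_mod m (h [^] i) (h [^] j)"
proof -
  obtain l where l: "cong_mod m h (x [^] (l::int))" using x_generates_mod assms by blast
  have "cong_mod m (h [^] i) (x [^] (i * l))" "cong_mod m (h [^] j) (x [^] (j * l))"
    using cong_mod_pow[OF l, of i] cong_mod_pow[OF l, of j] by (simp_all add: int_pow_pow mult.commute)
  moreover have "cong_mod m (x [^] (i * l)) (x [^] (j * l))"
    using cong_mod_pow[OF assms(3), of l] by (simp add: int_pow_pow)
  ultimately show ?thesis using cong_mod_trans cong_mod_sym by blast
qed

lemma corresponds_unique:
  assumes h: "h \<in> carrier G" and a: "a \<in> carrier G"
    and "corresponds h a c" "corresponds h a c'"
  shows "c = c'"
proof -
  obtain n k where n: "n \<noteq> 0" "a [^] (n::int) = x [^] (k::int)" "c [^] n = h [^] k"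
    using assms by (auto simp: corresponds_def)
  obtain n' k' where n': "n' \<noteq> 0" "a [^] (n'::int) = x [^] (k'::int)" "c' [^] n' = h [^] k'"
    using assms by (auto simp: corresponds_def)
  have cc: "c \<in> carrier G" "c' \<in> carrier G" using assms by (auto simp: corresponds_def)
  have "x [^] (k * n') = (a [^] n) [^] n'" using n by (simp add: int_pow_pow)
  also have "\<dots> = (a [^] n') [^] n" using a by (simp add: int_pow_pow mult.commute)
  also have "\<dots> = x [^] (k' * n)" using n' by (simp add: int_pow_pow)
  finally have "x [^] (k * n' - k' * n) = \<one>" by (simp add: int_pow_diff)
  then have k: "k * n' = k' * n" using x_infinite_order by fastforce
  show ?thesis
  proof (rule torsion_cong_imp_eq[OF cc, of "n * n'"])
    show "n * n' \<noteq> 0" using n n' by simp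
    have "c [^] (n * n') = (c [^] n) [^] n'" using cc by (simp add: int_pow_pow)
    also have "\<dots> = h [^] (k * n')" using n h by (simp add: int_pow_pow)
    also have "\<dots> = (c' [^] n') [^] n" using n' h k by (simp add: int_pow_pow)
    also have "\<dots> = c' [^] (n * n')" using cc by (simp add: int_pow_pow mult.commute)
    finally show "c [^] (n * n') = c' [^] (n * n')" .
    show "cong_mod m c c'" if "m \<noteq> 0" for m
    proof -
      obtain j where "cong_mod m a (x [^] (j::int))" using x_generates_mod a \<open>m \<noteq> 0\<close> by blast
      then have "cong_mod m c (h [^] j)" "cong_mod m c' (h [^] j)"
        using assms \<open>m \<noteq> 0\<close> by (auto simp: corresponds_def)
      then show ?thesis using cong_mod_trans cong_mod_sym by blast
    qed
  qed
qed

lemma corresponds_mult: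
  assumes h: "h \<in> carrier G" and a: "a \<in> carrier G" and b: "b \<in> carrier G"
    and c: "corresponds h a c" and d: "corresponds h b d"
  shows "corresponds h (a \<otimes> b) (c \<otimes> d)"
  unfolding corresponds_def
proof (intro conjI allI impI)
  have cc: "c \<in> carrier G" "d \<in> carrier G" using assms by (auto simp: corresponds_def)
  then show "c \<otimes> d \<in> carrier G" by simp
  fix m j :: int assume m: "m \<noteq> 0" "cong_mod m (a \<otimes> b) (x [^] j)"
  obtain i :: int where i: "cong_mod m a (x [^] i)" using x_generates_mod a m by blast
  have "cong_mod m (inv a \<otimes> (a \<otimes> b)) (inv (x [^] i) \<otimes> x [^] j)"
    using cong_mod_mult[OF cong_mod_inv[OF i] m(2)] .
  moreover have "inv a \<otimes> (a \<otimes> b) = b" using a b by (simp add: m_assoc[symmetric])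
  moreover have "inv (x [^] i) \<otimes> x [^] j = x [^] (j - i)" by (simp add: int_pow_diff m_comm)
  ultimately have bi: "cong_mod m b (x [^] (j - i))" by simp
  have "cong_mod m (c \<otimes> d) (h [^] i \<otimes> h [^] (j - i))"
    using c d i bi m by (intro cong_mod_mult) (auto simp: corresponds_def)
  then show "cong_mod m (c \<otimes> d) (h [^] j)" using h by (simp add: int_pow_mult[symmetric])
next
  have cc: "c \<in> carrier G" "d \<in> carrier G" using assms by (auto simp: corresponds_def)
  obtain n k where n: "n \<noteq> 0" "a [^] (n::int) = x [^] (k::int)" "c [^] n = h [^] k"
    using c by (auto simp: corresponds_def)
  obtain n' k' where n': "n' \<noteq> 0" "b [^] (n'::int) = x [^] (k'::int)" "d [^] n' = h [^] k'"
    using d by (auto simp: corresponds_def)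
  have *: "(u \<otimes> v) [^] (n * n') = y [^] (k * n' + k' * n)"
    if "u \<in> carrier G" "v \<in> carrier G" "y \<in> carrier G" "u [^] n = y [^] k" "v [^] n' = y [^] k'" for u v y
  proof -
    have "(u \<otimes> v) [^] (n * n') = (u [^] n) [^] n' \<otimes> (v [^] n') [^] n"
      using that(1-3) by (simp add: int_pow_distrib int_pow_pow mult.commute)
    then show ?thesis using that by (simp add: int_pow_pow int_pow_mult)
  qed
  show "\<exists>n k. n \<noteq> 0 \<and> (a \<otimes> b) [^] (n::int) = x [^] (k::int) \<and> (c \<otimes> d) [^] n = h [^] k"
    using *[OF a b x_closed n(2) n'(2)] *[OF cc h n(3) n'(3)] n(1) n'(1) mult_eq_0_iff by metis
qed

lemma corresponds_x: "h \<in> carrier G \<Longrightarrow> corresponds h x h"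
  unfolding corresponds_def
  using cong_mod_exponents[of h _ 1] by (auto intro!: exI[of _ 1])

text \<open>
  Let \<open>n a = k x\<close>. For a single modulus \<open>m\<close> an image with the right residue is found by solving for
  it in \<open>G\<close>, and two such images differ by an element killed by \<open>n\<close>. For a modulus \<open>m\<close> with
  \<open>G[n] \<subseteq> G[m]\<close> and \<open>G[m] \<inter> m G = 0\<close>, the residue modulo \<open>m\<close> leaves no freedom, so the solution for
  \<open>m\<close> coincides with the solution for every multiple of \<open>m\<close> and has all residues right.
\<close>

lemma corresponds_exists:
  assumes h: "h \<in> carrier G" and a: "a \<in> carrier G"
  shows "\<exists>c. corresponds h a c"
proof -
  obtain n k where n: "n \<noteq> 0" "a [^] (n::int) = x [^] (k::int)" using torsion_over_x a by blast
  have approx: "\<exists>c\<in>carrier G. c [^] n = h [^] k \<and> (\<forall>j::int. cong_mod m a (x [^] j) \<longrightarrow> cong_mod m c (h [^] j))"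
    if m: "m \<noteq> 0" for m
  proof -
    obtain j w where w: "w \<in> carrier G" "a = x [^] (j::int) \<otimes> w [^] m"
      using x_generates_mod[OF a m] by (meson cong_modE)
    \<comment> \<open>Approximating \<open>h\<close> modulo \<open>n m\<close> rather than \<open>m\<close> makes \<open>(k - j n) h\<close> divisible by \<open>n m\<close>, with the explicit quotient \<open>?v\<close>.\<close>
    obtain i y where y: "y \<in> carrier G" "h = x [^] (i::int) \<otimes> y [^] (n * m)"
      using x_generates_mod[OF h, of "n * m"] n(1) m by (metis cong_modE mult_eq_0_iff)
    have "x [^] k = x [^] (j * n) \<otimes> w [^] (m * n)"
      using n(2) w by (simp add: int_pow_distrib int_pow_pow)
    then have "x [^] (- (j * n)) \<otimes> x [^] k = x [^] (- (j * n)) \<otimes> x [^] (j * n) \<otimes> w [^] (m * n)"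
      using w(1) by (simp add: m_assoc)
    then have xw: "x [^] (k - j * n) = w [^] (m * n)"
      using w(1) by (simp add: int_pow_mult[symmetric])
    let ?v = "w [^] i \<otimes> y [^] (k - j * n)"
    have "?v [^] (m * n) = (w [^] (m * n)) [^] i \<otimes> (y [^] (n * m)) [^] (k - j * n)"
      using w y by (simp add: int_pow_distrib int_pow_pow ac_simps)
    also have "\<dots> = (x [^] i) [^] (k - j * n) \<otimes> (y [^] (n * m)) [^] (k - j * n)"
      by (simp add: xw[symmetric] int_pow_pow mult.commute)
    also have "\<dots> = h [^] (k - j * n)" using y by (simp add: int_pow_distrib)
    finally have v: "?v [^] (m * n) = h [^] (k - j * n)" .
    let ?c = "h [^] j \<otimes> ?v [^] m"
    have "?c [^] n = h [^] (j * n) \<otimes> ?v [^] (m * n)"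
      using w y(1) h by (simp add: int_pow_distrib int_pow_pow mult.assoc)
    also have "\<dots> = h [^] k" unfolding v using h by (simp add: int_pow_mult[symmetric])
    finally have c_pow: "?c [^] n = h [^] k" .
    have cj: "cong_mod m ?c (h [^] j)" using w y(1) h by (intro cong_modI[of _ ?v]) auto
    have "cong_mod m ?c (h [^] j')" if "cong_mod m a (x [^] j')" for j' :: int
    proof -
      have "cong_mod m a (x [^] j)" using w by (intro cong_modI) auto
      then have "cong_mod m (x [^] j) (x [^] j')" using that cong_mod_trans cong_mod_sym by blast
      then show ?thesis using cj cong_mod_exponents[OF h m] cong_mod_trans by blast
    qed
    then show ?thesis using c_pow w y(1) h by (intro bexI[of _ ?c]) auto
  qed
  obtain m where m: "fitting m" "\<And>u. u \<in> carrier G \<Longrightarrow> u [^] n = \<one> \<Longrightarrow> u [^] m = \<one>"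
    using exists_fitting n by blast
  have m0: "m \<noteq> 0" using m by (simp add: fitting_def)
  obtain c where c: "c \<in> carrier G" "c [^] n = h [^] k"
      "\<And>j::int. cong_mod m a (x [^] j) \<Longrightarrow> cong_mod m c (h [^] j)"
    using approx[OF m0] by blast
  have "cong_mod l c (h [^] j)" if l: "l \<noteq> 0" and j: "cong_mod l a (x [^] j)" for l and j :: int
  proof -
    obtain d where d: "d \<in> carrier G" "d [^] n = h [^] k"
        "\<And>j::int. cong_mod (l * m) a (x [^] j) \<Longrightarrow> cong_mod (l * m) d (h [^] j)"
      using approx[of "l * m"] l m0 by auto
    obtain i :: int where i: "cong_mod (l * m) a (x [^] i)"
      using x_generates_mod[OF a, of "l * m"] l m0 by auto
    have "cong_mod m d (h [^] i)" "cong_mod m c (h [^] i)"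
      using d(3)[OF i] c(3) cong_mod_dvd[OF i, of m] cong_mod_dvd[of _ _ _ m] by auto
    then have "cong_mod m (c \<otimes> inv d) \<one>"
      using c d cong_mod_div_iff cong_mod_trans cong_mod_sym by meson
    moreover have "(c \<otimes> inv d) [^] m = \<one>"
      using c(1,2) d(1,2) h by (intro m(2)) (auto simp: int_pow_distrib int_pow_inv)
    ultimately have "c \<otimes> inv d = \<one>" using fitting_disjoint[OF m(1)] c(1) d(1) by blast
    then have "c = d" using c(1) d(1) by (metis eq_if_div_eq_one)
    then have "cong_mod l c (h [^] i)" using d(3)[OF i] cong_mod_dvd by simp
    moreover have "cong_mod l a (x [^] i)" by (rule cong_mod_dvd[OF i]) simp
    then have "cong_mod l (x [^] i) (x [^] j)" using j cong_mod_trans cong_mod_sym by blast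
    ultimately show ?thesis using cong_mod_exponents[OF h l] cong_mod_trans by blast
  qed
  then show ?thesis using c n unfolding corresponds_def by blast
qed

definition endo :: "'a \<Rightarrow> 'a \<Rightarrow> 'a" where
  "endo h a = (SOME c. corresponds h a c)"

lemma corresponds_endo:
  "\<lbrakk>h \<in> carrier G; a \<in> carrier G\<rbrakk> \<Longrightarrow> corresponds h a (endo h a)"
  unfolding endo_def by (rule someI_ex) (rule corresponds_exists)

lemma endo_closed: "\<lbrakk>h \<in> carrier G; a \<in> carrier G\<rbrakk> \<Longrightarrow> endo h a \<in> carrier G"
  using corresponds_endo by (auto simp: corresponds_def)

lemma endo_hom:
  assumes h: "h \<in> carrier G" shows "endo h \<in> hom G G"
proof (rule homI)
  fix a b assume "a \<in> carrier G" "b \<in> carrier G"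
  then show "endo h (a \<otimes> b) = endo h a \<otimes> endo h b"
    using corresponds_unique[OF h, of "a \<otimes> b"] corresponds_mult[OF h] corresponds_endo[OF h] by simp
qed (rule endo_closed[OF h])

lemma endo_x: "h \<in> carrier G \<Longrightarrow> endo h x = h"
  by (rule corresponds_unique[OF _ x_closed corresponds_endo corresponds_x]) auto

lemma hom_mult_pointwise:
  "\<lbrakk>f \<in> hom G G; f' \<in> hom G G\<rbrakk> \<Longrightarrow> (\<lambda>a. f a \<otimes> f' a) \<in> hom G G"
  by (auto simp: hom_def m_ac Pi_iff)

text \<open>
  By uniqueness of endomorphisms with given value at \<open>x\<close>, \<open>endo v u\<close> is additive in \<open>v\<close> as well, so
  it is a multiplication, and \<open>f\<close> is its right multiplication by \<open>f x\<close>.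
\<close>

lemma absolute_ideal_invariant_under_endos:
  assumes I: "absolute_ideal G I" and f: "f \<in> hom G G" and a: "a \<in> I"
  shows "f a \<in> I"
proof -
  have fx: "f x \<in> carrier G" by (rule hom_in_carrier[OF f x_closed])
  have ac: "a \<in> carrier G" using I a by (auto simp: absolute_ideal_def dest: subgroup.mem_carrier)
  obtain \<mu> where \<mu>: "\<mu> \<in> multiplications G"
      "\<And>u v. \<lbrakk>u \<in> carrier G; v \<in> carrier G\<rbrakk> \<Longrightarrow> ring_product G \<mu> u v = endo v u"
  proof (rule biadditive_imp_multiplication[OF comm_group_axioms, of "\<lambda>u v. endo v u"])
    fix u v w assume u: "u \<in> carrier G" and v: "v \<in> carrier G" and w: "w \<in> carrier G"
    show "endo v u \<in> carrier G" using v u by (rule endo_closed)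
    show "endo w (u \<otimes> v) = endo w u \<otimes> endo w v" by (rule hom_mult[OF endo_hom[OF w] u v])
    have "endo (v \<otimes> w) x = endo v x \<otimes> endo w x" using v w by (simp add: endo_x)
    then show "endo (v \<otimes> w) u = endo v u \<otimes> endo w u"
      using hom_eqI[OF endo_hom hom_mult_pointwise[OF endo_hom endo_hom] _ u] v w by simp
  qed (use that in blast)
  have "endo (f x) a = f a" by (rule hom_eqI[OF endo_hom[OF fx] f endo_x[OF fx] ac])
  moreover have "ring_product G \<mu> a (f x) \<in> I"
    using I \<mu>(1) a fx by (auto simp: absolute_ideal_def ideal_in_ring_on_def)
  ultimately show ?thesis using \<mu>(2)[OF ac fx] by simp
qed

section \<open>Elements reached by endomorphisms\<close>

text \<open>
  Modulo \<open>p\<^sup>k G\<close> the element \<open>g\<close> is \<open>j x\<close>. With \<open>p\<^sup>i = gcd j p\<^sup>k\<close>, the multiples of \<open>g\<close> are exactly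
  the multiples of \<open>p\<^sup>i x\<close> there, and \<open>g\<close>, hence \<open>h\<close>, is divisible by \<open>p\<^sup>i\<close>. So \<open>h\<close> is a multiple of \<open>p\<^sup>i x\<close> modulo \<open>p\<^sup>k G\<close>.
\<close>

lemma heights_imp_cong_prime_power:
  assumes g: "g \<in> carrier G" and h: "h \<in> carrier G" and p: "Factorial_Ring.prime (p::nat)"
    and le: "\<And>k. cong_mod (int p ^ k) g \<one> \<Longrightarrow> cong_mod (int p ^ k) h \<one>"
  shows "\<exists>c::int. cong_mod (int p ^ k) h (g [^] c)"
proof -
  let ?P = "int p ^ k"
  have P0: "?P \<noteq> 0" using p by auto
  obtain j :: int where j: "cong_mod ?P g (x [^] j)" using x_generates_mod[OF g P0] by blast
  have "Factorial_Ring.prime (int p)" using p by simp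
  then obtain i where i: "i \<le> k" "gcd j ?P = int p ^ i"
    using divides_primepow[of "int p" "gcd j ?P" k] by auto
  have dvd: "int p ^ i dvd j" "int p ^ i dvd ?P" by (metis i(2) gcd_dvd1, metis i(2) gcd_dvd2)
  obtain u v where uv: "u * j + v * ?P = int p ^ i" using bezout_int[of j ?P] i by auto
  obtain j' where j': "j = int p ^ i * j'" using dvd by auto
  have "cong_mod (int p ^ i) (x [^] j) \<one>"
    unfolding cong_mod_one_iff j' by (intro bexI[of _ "x [^] j'"]) (auto simp: int_pow_pow mult.commute)
  then have "cong_mod (int p ^ i) g \<one>" using cong_mod_dvd[OF j dvd(2)] cong_mod_trans by blast
  then obtain s where s: "s \<in> carrier G" "h = s [^] (int p ^ i)" using le by (auto simp: cong_mod_one_iff)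
  obtain l :: int where l: "cong_mod ?P s (x [^] l)" using x_generates_mod[OF s(1) P0] by blast
  have "x [^] (int p ^ i) = x [^] (j * u) \<otimes> (x [^] v) [^] ?P"
    unfolding uv[symmetric] by (simp add: int_pow_mult int_pow_pow mult.commute)
  then have "cong_mod ?P (x [^] (int p ^ i)) ((x [^] j) [^] u)" by (intro cong_modI[of _ "x [^] v"]) (auto simp: int_pow_pow)
  then have xg: "cong_mod ?P (x [^] (int p ^ i)) (g [^] u)"
    using cong_mod_pow[OF cong_mod_sym[OF j]] cong_mod_trans by blast
  have "cong_mod ?P h ((x [^] l) [^] (int p ^ i))" using cong_mod_pow[OF l] s by simp
  moreover have "(x [^] l) [^] (int p ^ i) = (x [^] (int p ^ i)) [^] l" by (simp add: int_pow_pow mult.commute)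
  ultimately have "cong_mod ?P h ((g [^] u) [^] l)" using cong_mod_pow[OF xg] cong_mod_trans by metis
  then show ?thesis using g by (auto simp: int_pow_pow)
qed

lemma heights_imp_cong:
  assumes g: "g \<in> carrier G" and h: "h \<in> carrier G"
    and le: "char_le (characteristic G g) (characteristic G h)" and n: "n \<noteq> 0"
  shows "\<exists>c::int. cong_mod n h (g [^] c)"
proof -
  have nat: "\<exists>c::int. cong_mod (int n) h (g [^] c)" if "n > 0" for n
    using that
  proof (induction n rule: less_induct)
    case (less n)
    show ?case
    proof (cases "n = 1")
      case True
      have "cong_mod 1 h \<one>" unfolding cong_mod_one_iff using h by auto
      then show ?thesis using True by (intro exI[of _ 0]) simp
    next
      case False
      then obtain p where p: "Factorial_Ring.prime p" "p dvd n" using prime_factor_nat by blast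
      obtain a q where q: "n = p ^ a * q" "\<not> p dvd q"
        using less.prems p(1) multiplicity_decompose'[of n p] by (metis neq0_conv not_prime_unit)
      have "0 < a" using p(2) q by (cases a) auto
      \<comment> \<open>The prime power must be nontrivial for the cofactor \<open>q\<close> to be smaller than \<open>n\<close>.\<close>
      then have "1 < p ^ a" using p by (intro one_less_power prime_gt_1_nat)
      moreover have "0 < q" using q(1) less.prems by (cases q) auto
      ultimately have "q < n" using n_less_m_mult_n[of q "p ^ a"] q(1) by simp
      then obtain b where b: "cong_mod (int q) h (g [^] (b::int))" using less.IH \<open>0 < q\<close> by blast
      obtain c where c: "cong_mod (int p ^ a) h (g [^] (c::int))"
        using heights_imp_cong_prime_power[OF g h p(1)] le p(1) unfolding char_le_iff[OF g h] by blast
      have "coprime (int p ^ a) (int q)"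
        using p q(2) by (metis coprime_int_iff coprime_power_left_iff of_nat_power prime_imp_coprime)
      then have "\<exists>c::int. cong_mod (int p ^ a * int q) h (g [^] c)" using cong_mod_crt[OF c b] g by blast
      then show ?thesis unfolding q(1) by simp
    qed
  qed
  obtain c :: int where "cong_mod (int (nat \<bar>n\<bar>)) h (g [^] c)" using nat[of "nat \<bar>n\<bar>"] n by auto
  then show ?thesis using cong_mod_dvd[of "int (nat \<bar>n\<bar>)" _ _ n] by auto
qed

text \<open>
  Split \<open>G = G[m] \<oplus> m G\<close> with \<open>h \<in> G[m]\<close>. The projection to \<open>G[m]\<close> is the endomorphism sending \<open>x\<close>
  to its own component; it fixes residues modulo \<open>m\<close>, so it turns \<open>h \<equiv> c g\<close> into an equation.
\<close>

lemma torsion_is_multiple_of_image: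
  assumes g: "g \<in> carrier G" and h: "h \<in> torsion_part G"
    and cong: "\<And>m. m \<noteq> 0 \<Longrightarrow> \<exists>c::int. cong_mod m h (g [^] c)"
  shows "\<exists>f\<in>hom G G. \<exists>c::int. h = f g [^] c"
proof -
  obtain n :: int where hc: "h \<in> carrier G" and n: "n \<noteq> 0" "h [^] n = \<one>" using h by (auto simp: torsion_part_iff)
  obtain m where m: "fitting m" "\<And>u. u \<in> carrier G \<Longrightarrow> u [^] n = \<one> \<Longrightarrow> u [^] m = \<one>"
    using exists_fitting n by blast
  have m0: "m \<noteq> 0" using m by (simp add: fitting_def)
  obtain b where b: "b \<in> carrier G" "b [^] m = \<one>" "cong_mod m x b" using fitting_split[OF m(1) x_closed] by blast
  let ?f = "endo b"
  have f: "?f \<in> hom G G" using endo_hom b by blast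
  have fg: "?f g \<in> carrier G" using endo_closed b g by blast
  \<comment> \<open>The endomorphism \<open>m ?f\<close> kills \<open>x\<close>, hence is zero, so the image of \<open>?f\<close> lies in \<open>G[m]\<close>.\<close>
  have "(\<lambda>a. ?f a [^] m) \<in> hom G G"
    using f by (auto intro!: homI simp: hom_mult hom_in_carrier int_pow_distrib)
  moreover have "(\<lambda>a. \<one>) \<in> hom G G" by (auto intro: homI)
  ultimately have fgm: "?f g [^] m = \<one>" using hom_eqI[of "\<lambda>a. ?f a [^] m" "\<lambda>a. \<one>" g] b g by (simp add: endo_x)
  obtain j :: int where j: "cong_mod m g (x [^] j)" using x_generates_mod[OF g m0] by blast
  have "cong_mod m (?f g) (b [^] j)"
    using cong_mod_hom[OF f j] hom_int_pow[OF f x_closed is_group is_group] endo_x b by simp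
  moreover have "cong_mod m (b [^] j) (x [^] j)" using cong_mod_pow cong_mod_sym b(3) by blast
  ultimately have f_cong: "cong_mod m (?f g) g" using j cong_mod_trans cong_mod_sym by blast
  obtain c :: int where c: "cong_mod m h (g [^] c)" using cong m0 by blast
  have "cong_mod m h (?f g [^] c)" using c cong_mod_pow[OF f_cong] cong_mod_trans cong_mod_sym by blast
  then have "cong_mod m (h \<otimes> inv (?f g [^] c)) \<one>" using hc fg by (simp add: cong_mod_div_iff)
  moreover have "(?f g [^] c) [^] m = \<one>"
    using pow_eq_one_mult[OF fg fgm, of c] fg by (simp add: int_pow_pow mult.commute)
  then have "(h \<otimes> inv (?f g [^] c)) [^] m = \<one>"
    using m(2)[OF hc n(2)] hc fg by (simp add: int_pow_distrib int_pow_inv)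
  ultimately have "h \<otimes> inv (?f g [^] c) = \<one>" using fitting_disjoint[OF m(1)] hc fg by blast
  then have "h = ?f g [^] c" using hc fg by (metis eq_if_div_eq_one int_pow_closed)
  then show ?thesis using f by blast
qed

text \<open>
  For \<open>g\<close> of infinite order, \<open>n g = k x\<close> with \<open>k \<noteq> 0\<close>. From \<open>h \<in> \<langle>g\<rangle> + k G\<close> it follows that
  \<open>n h \<in> \<langle>n g\<rangle> + k G = k G\<close>, say \<open>n h = k u\<close>. The endomorphism sending \<open>x\<close> to \<open>u\<close> sends \<open>n g\<close> to
  \<open>n h\<close>, so it reaches \<open>h\<close> up to torsion. As endomorphisms preserve the subgroups \<open>\<langle>g\<rangle> + m G\<close>,
  the torsion difference is covered by the preceding lemma.
\<close>

lemma mem_absolute_ideal: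
  assumes I: "absolute_ideal G I" and g: "g \<in> I" and h: "h \<in> carrier G"
    and le: "char_le (characteristic G g) (characteristic G h)"
    and tors: "g \<in> torsion_part G \<Longrightarrow> h \<in> torsion_part G"
  shows "h \<in> I"
proof -
  have sub: "subgroup I G" using I by (simp add: absolute_ideal_def)
  have gc: "g \<in> carrier G" using g sub subgroup.mem_carrier by metis
  have f_in: "f g [^] (c::int) \<in> I" if "f \<in> hom G G" for f c
    using absolute_ideal_invariant_under_endos[OF I that g] sub by (simp add: subgroup_int_pow_closed)
  have cong: "\<exists>c::int. cong_mod m h (g [^] c)" if "m \<noteq> 0" for m
    using heights_imp_cong[OF gc h le that] .
  show ?thesis
  proof (cases "h \<in> torsion_part G")
    case True
    then show ?thesis using torsion_is_multiple_of_image[OF gc _ cong] f_in by blast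
  next
    case False
    obtain n k where n: "n \<noteq> 0" "g [^] (n::int) = x [^] (k::int)" using torsion_over_x gc by blast
    have "g \<notin> torsion_part G" using tors False by blast
    then have k: "k \<noteq> 0" using n gc by (auto simp: torsion_part_iff)
    obtain c :: int where c: "cong_mod k h (g [^] c)" using cong k by blast
    have "(g [^] c) [^] n = (g [^] n) [^] c" using gc by (simp add: int_pow_pow mult.commute)
    also have "\<dots> = (x [^] c) [^] k" unfolding n(2) by (simp add: int_pow_pow mult.commute)
    finally have "cong_mod k ((g [^] c) [^] n) \<one>" unfolding cong_mod_one_iff by auto
    then have "cong_mod k (h [^] n) \<one>" using cong_mod_pow[OF c] cong_mod_trans by blast
    then obtain u where u: "u \<in> carrier G" "h [^] n = u [^] k" unfolding cong_mod_one_iff by blast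
    let ?f = "endo u"
    note pow = hom_int_pow[OF endo_hom[OF u(1)] _ is_group is_group]
    have f: "?f \<in> hom G G" using endo_hom u by blast
    have fg: "?f g \<in> carrier G" using endo_closed u gc by blast
    have "?f g [^] n = h [^] n" using pow[OF gc, of n] pow[OF x_closed, of k] n u endo_x by simp
    then have "(h \<otimes> inv (?f g)) [^] n = \<one>" using h fg by (simp add: int_pow_distrib int_pow_inv)
    then have d_tors: "h \<otimes> inv (?f g) \<in> torsion_part G" unfolding torsion_part_iff using n h fg by auto
    have "\<exists>c::int. cong_mod m (h \<otimes> inv (?f g)) (g [^] c)" if m: "m \<noteq> 0" for m
    proof -
      obtain c :: int where c: "cong_mod m h (g [^] c)" using cong m by blast
      obtain j :: int where j: "cong_mod m g (x [^] j)" using x_generates_mod[OF gc m] by blast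
      obtain i :: int where i: "cong_mod m u (x [^] i)" using x_generates_mod[OF u(1) m] by blast
      have "cong_mod m (?f g) (u [^] j)"
        using cong_mod_hom[OF f j] pow[OF x_closed, of j] endo_x[OF u(1)] by simp
      moreover have "cong_mod m (u [^] j) ((x [^] j) [^] i)"
        using cong_mod_pow[OF i, of j] by (simp add: int_pow_pow mult.commute)
      moreover have "cong_mod m ((x [^] j) [^] i) (g [^] i)" using cong_mod_pow cong_mod_sym j by blast
      ultimately have "cong_mod m (?f g) (g [^] i)" using cong_mod_trans by blast
      from cong_mod_mult[OF c cong_mod_inv[OF this]]
      show ?thesis using gc by (auto simp: int_pow_diff[symmetric])
    qed
    from torsion_is_multiple_of_image[OF gc d_tors this]
    have "h \<otimes> inv (?f g) \<in> I" using f_in by force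
    moreover have "?f g \<in> I" using f_in[OF f, of 1] fg by simp
    ultimately have "h \<otimes> inv (?f g) \<otimes> ?f g \<in> I" by (rule subgroup.m_closed[OF sub])
    then show ?thesis using h fg by (simp add: m_assoc)
  qed
qed

end

section \<open>Quotient divisible groups of torsion-free rank one\<close>

context comm_group
begin

text \<open>
  By maximality of \<open>{s}\<close>, each \<open>b\<close> of infinite order has a nontrivial relation with \<open>s\<close>, and both
  its coefficients are nonzero because neither element is torsion.
\<close>

lemma rank_one_infinite_order_dependent:
  assumes rank: "has_torsion_free_rank G 1"
  obtains s where "s \<in> carrier G" "s \<notin> torsion_part G"
    "\<And>b. \<lbrakk>b \<in> carrier G; b \<notin> torsion_part G\<rbrakk>
      \<Longrightarrow> \<exists>(i::int) (j::int). i \<noteq> 0 \<and> j \<noteq> 0 \<and> b [^] i = s [^] j"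
proof -
  obtain S where S: "independent_set G S" "\<And>S'. independent_set G S' \<and> S \<subseteq> S' \<Longrightarrow> S' = S" "card S = 1"
    using rank by (auto simp: has_torsion_free_rank_def)
  obtain s where s: "S = {s}" using S(3) by (auto simp: card_1_singleton_iff)
  have sc: "s \<in> carrier G" using S(1) s by (simp add: independent_set_def)
  have s_free: "k = 0" if "s [^] k = \<one>" for k :: int
  proof -
    have "finprod G (\<lambda>t. t [^] k) {s} = \<one>" using that sc by simp
    moreover have "\<forall>A (c :: 'a \<Rightarrow> int). finite A \<and> A \<subseteq> {s} \<and> finprod G (\<lambda>t. t [^] c t) A = \<one>
        \<longrightarrow> (\<forall>t\<in>A. c t = 0)"
      using S(1) unfolding independent_set_def s by blast
    from this[rule_format, of "{s}" "\<lambda>_. k" s]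
    have "finprod G (\<lambda>t. t [^] k) {s} = \<one> \<Longrightarrow> k = 0" by simp
    ultimately show ?thesis by blast
  qed
  show thesis
  proof (rule that[OF sc])
    show "s \<notin> torsion_part G" using s_free by (auto simp: torsion_part_iff)
    fix b assume b: "b \<in> carrier G" "b \<notin> torsion_part G"
    have b_free: "k = 0" if "b [^] k = \<one>" for k :: int using that b by (auto simp: torsion_part_iff)
    show "\<exists>(i::int) (j::int). i \<noteq> 0 \<and> j \<noteq> 0 \<and> b [^] i = s [^] j"
    proof (cases "b = s")
      case True
      then show ?thesis by (intro exI[of _ 1]) auto
    next
      case False
      then have "\<not> independent_set G {s, b}" using S(2)[of "{s, b}"] s by auto
      then obtain A and c :: "'a \<Rightarrow> int" where A: "A \<subseteq> {s, b}" "finprod G (\<lambda>t. t [^] c t) A = \<one>"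
          and nz: "\<exists>t\<in>A. c t \<noteq> 0"
        using sc b(1) unfolding independent_set_def by auto
      \<comment> \<open>Extending the coefficients by zero treats all subsets \<open>A\<close> of \<open>{s, b}\<close> at once.\<close>
      define c' where "c' t = (if t \<in> A then c t else 0)" for t
      have "finprod G (\<lambda>t. t [^] c' t) {s, b} = finprod G (\<lambda>t. t [^] c t) A"
        using A(1) sc b(1) by (intro finprod_mono_neutral_cong_left[symmetric]) (auto simp: c'_def)
      then have rel: "s [^] c' s \<otimes> b [^] c' b = \<one>" using A(2) False sc b(1) by simp
      have nz': "c' s \<noteq> 0 \<or> c' b \<noteq> 0" using nz A(1) by (auto simp: c'_def)
      have "c' b \<noteq> 0"
      proof
        assume "c' b = 0"
        then show False using rel nz' s_free[of "c' s"] sc by simp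
      qed
      moreover have "c' s \<noteq> 0"
      proof
        assume "c' s = 0"
        then show False using rel nz' b_free[of "c' b"] b(1) by simp
      qed
      moreover have "inv (b [^] c' b) = s [^] c' s" using rel sc b(1) by (intro inv_equality) auto
      then have "b [^] c' b = s [^] (- c' s)" using sc b(1) by (metis int_pow_closed int_pow_neg inv_inv)
      ultimately show ?thesis by (intro exI[of _ "c' b"] exI[of _ "- c' s"]) simp
    qed
  qed
qed

lemma rank_one_infinite_order_dependent_pair:
  assumes rank: "has_torsion_free_rank G 1"
    and a: "a \<in> carrier G" "a \<notin> torsion_part G" and b: "b \<in> carrier G" "b \<notin> torsion_part G"
  shows "\<exists>(i::int) (j::int). i \<noteq> 0 \<and> a [^] i = b [^] j"
proof -
  obtain s where s: "s \<in> carrier G" "s \<notin> torsion_part G"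
    "\<And>b. \<lbrakk>b \<in> carrier G; b \<notin> torsion_part G\<rbrakk>
      \<Longrightarrow> \<exists>(i::int) (j::int). i \<noteq> 0 \<and> j \<noteq> 0 \<and> b [^] i = s [^] j"
    using rank_one_infinite_order_dependent[OF rank] by blast
  obtain i j :: int where ij: "i \<noteq> 0" "j \<noteq> 0" "a [^] i = s [^] j" using s(3)[OF a] by blast
  obtain k l :: int where kl: "k \<noteq> 0" "l \<noteq> 0" "b [^] k = s [^] l" using s(3)[OF b] by blast
  have "a [^] (i * l) = (s [^] l) [^] j" using a(1) s(1) ij by (simp add: int_pow_pow[symmetric]) (simp add: int_pow_pow mult.commute)
  also have "\<dots> = b [^] (k * j)" using b(1) kl(3) by (simp add: int_pow_pow[symmetric])
  finally show ?thesis using ij(1) kl(2) by (metis mult_eq_0_iff)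
qed

end

text \<open>
  A free basis of the finite-rank subgroup has at least one element, since its quotient is torsion
  and \<open>G\<close> is not. It has at most one, since two basis elements would have a nontrivial relation.
\<close>

lemma QD1_imp_rank_one_quotient_divisible:
  assumes "G \<in> QD1"
  obtains x where "rank_one_quotient_divisible G x"
proof -
  have qd: "quotient_divisible G" and rank: "has_torsion_free_rank G 1" using assms by (auto simp: QD1_def)
  interpret comm_group G using qd by (simp add: quotient_divisible_def)
  obtain F where F: "subgroup F G" "free_finite_rank (G\<lparr>carrier := F\<rparr>)" "divisible_group (G Mod F)"
      "torsion_group (G Mod F)"
    using qd by (auto simp: quotient_divisible_def)
  interpret F: normal F G using F(1) by (rule subgroup_imp_normal)
  have Fc: "f \<in> carrier G" if "f \<in> F" for f using F(1) that by (rule subgroup.mem_carrier)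
  have torsion_mod_F: "\<exists>m::int. m \<noteq> 0 \<and> a [^]\<^bsub>G\<^esub> m \<in> F" if a: "a \<in> carrier G" for a
  proof -
    have "F #>\<^bsub>G\<^esub> a \<in> carrier (G Mod F)" using a by (auto simp: carrier_FactGroup)
    then obtain m :: nat where m: "0 < m" "(F #>\<^bsub>G\<^esub> a) [^]\<^bsub>G Mod F\<^esub> m = \<one>\<^bsub>G Mod F\<^esub>"
      using F(4) unfolding torsion_group_def torsion_part_def by blast
    then have "F #>\<^bsub>G\<^esub> (a [^]\<^bsub>G\<^esub> m) = F" using a by (simp add: F.FactGroup_pow)
    then have "a [^]\<^bsub>G\<^esub> m \<in> F" using rcos_self[OF nat_pow_closed[OF a] F(1)] by metis
    then show ?thesis using m(1) by (intro exI[of _ "int m"]) (simp add: int_pow_int)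
  qed
  have divisible_mod_F: "\<exists>f\<in>F. cong_mod m a f" if a: "a \<in> carrier G" and m: "m \<noteq> 0" for a m
  proof -
    have "F #>\<^bsub>G\<^esub> a \<in> carrier (G Mod F)" using a by (auto simp: carrier_FactGroup)
    moreover obtain N :: nat where N: "0 < N" "int N = \<bar>m\<bar>" using m by (metis abs_eq_0 abs_ge_zero of_nat_0 zero_le_imp_eq_int neq0_conv)
    ultimately obtain B where B: "B \<in> carrier (G Mod F)" "B [^]\<^bsub>G Mod F\<^esub> N = F #>\<^bsub>G\<^esub> a"
      using F(3) unfolding divisible_group_def by blast
    then obtain b where b: "b \<in> carrier G" "B = F #>\<^bsub>G\<^esub> b" by (auto simp: carrier_FactGroup)
    then have "F #>\<^bsub>G\<^esub> (b [^]\<^bsub>G\<^esub> N) = F #>\<^bsub>G\<^esub> a" using B(2) by (simp add: F.FactGroup_pow)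
    then have "a \<in> F #>\<^bsub>G\<^esub> (b [^]\<^bsub>G\<^esub> N)" using rcos_self[OF a F(1)] by metis
    then obtain f where f: "f \<in> F" "a = f \<otimes>\<^bsub>G\<^esub> b [^]\<^bsub>G\<^esub> N" unfolding r_coset_def by blast
    then have "cong_mod (int N) a f" using b Fc by (intro cong_modI[of _ b]) (auto simp: int_pow_int)
    then have "cong_mod m a f" by (rule cong_mod_dvd) (simp add: N(2))
    then show ?thesis using f by blast
  qed
  obtain r :: nat where "G\<lparr>carrier := F\<rparr> \<cong> free_Abelian_group {..<r}" using F(2) by (auto simp: free_finite_rank_def)
  then have "free_Abelian_group {..<r} \<cong> G\<lparr>carrier := F\<rparr>"
    using group.iso_sym[OF subgroup.subgroup_is_group[OF F(1) is_group]] by blast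
  then obtain \<phi> where \<phi>: "\<phi> \<in> iso (free_Abelian_group {..<r}) (G\<lparr>carrier := F\<rparr>)" by (auto simp: is_iso_def)
  have hom: "\<phi> \<in> hom (free_Abelian_group {..<r}) G" using \<phi> Fc by (auto simp: iso_def hom_def Pi_iff)
  have inj: "inj_on \<phi> (carrier (free_Abelian_group {..<r}))" and img: "\<phi> ` carrier (free_Abelian_group {..<r}) = F"
    using \<phi> by (auto simp: iso_def bij_betw_def)
  have pow: "\<phi> (frag_cmul k y) = \<phi> y [^]\<^bsub>G\<^esub> k" if "Poly_Mapping.keys y \<subseteq> {..<r}" for k y
    using hom_int_pow[OF hom, of y k] that is_group by simp
  have gen_c: "\<phi> (frag_of i) \<in> carrier G" if "i < r" for i using hom_in_carrier[OF hom] that by simp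
  have phi0: "\<phi> 0 = \<one>\<^bsub>G\<^esub>" using hom_one[OF hom] is_group by simp
  have gen_free: "k = 0" if "i < r" "\<phi> (frag_of i) [^]\<^bsub>G\<^esub> (k::int) = \<one>\<^bsub>G\<^esub>" for i k
  proof -
    have "\<phi> (frag_cmul k (frag_of i)) = \<phi> 0" using that pow[of "frag_of i" k] phi0 by simp
    then have "frag_cmul k (frag_of i) = 0"
      using that(1) by (intro inj_onD[OF inj]) (auto simp: keys_cmul)
    then show ?thesis by simp
  qed
  have gen_nt: "\<phi> (frag_of i) \<notin> torsion_part G" if "i < r" for i
    using gen_free[OF that] by (auto simp: torsion_part_iff)
  have "r \<noteq> 0"
  proof
    assume "r = 0"
    then have "F = {\<one>\<^bsub>G\<^esub>}" using img phi0 by auto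
    moreover obtain s where "s \<in> carrier G" "s \<notin> torsion_part G"
      using rank_one_infinite_order_dependent[OF rank] by blast
    ultimately show False using torsion_mod_F by (auto simp: torsion_part_iff)
  qed
  moreover have "\<not> 1 < r"
  proof
    assume r: "1 < r"
    then obtain i j :: int where ij: "i \<noteq> 0" "\<phi> (frag_of 0) [^]\<^bsub>G\<^esub> i = \<phi> (frag_of 1) [^]\<^bsub>G\<^esub> j"
      using rank_one_infinite_order_dependent_pair[OF rank gen_c gen_nt gen_c gen_nt, of 0 1] by auto
    then have "\<phi> (frag_cmul i (frag_of 0)) = \<phi> (frag_cmul j (frag_of 1))" using pow r by simp
    then have "frag_cmul i (frag_of 0) = frag_cmul j (frag_of (1::nat))"
      using r by (intro inj_onD[OF inj]) (auto simp: keys_cmul)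
    then have "Poly_Mapping.lookup (frag_cmul i (frag_of (0::nat))) 0 = Poly_Mapping.lookup (frag_cmul j (frag_of 1)) (0::nat)"
      by (simp only:)
    then show False using ij(1) by simp
  qed
  ultimately have r: "r = 1" by simp
  let ?x = "\<phi> (frag_of 0)"
  have F_cyclic: "\<exists>k::int. f = ?x [^]\<^bsub>G\<^esub> k" if f: "f \<in> F" for f
  proof -
    obtain y where y: "Poly_Mapping.keys y \<subseteq> {..<r}" "f = \<phi> y" using f img by auto
    have "y = frag_cmul (Poly_Mapping.lookup y 0) (frag_of 0)"
    proof (rule poly_mapping_eqI)
      fix i
      have "Poly_Mapping.lookup y i = 0" if "i \<noteq> 0"
      proof -
        have "i \<notin> Poly_Mapping.keys y" using that y(1) r by auto
        then show ?thesis by (simp add: in_keys_iff)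
      qed
      then show "Poly_Mapping.lookup y i = Poly_Mapping.lookup (frag_cmul (Poly_Mapping.lookup y 0) (frag_of 0)) i"
        by (cases "i = 0") (auto simp: lookup_one)
    qed
    then have "f = \<phi> (frag_cmul (Poly_Mapping.lookup y 0) (frag_of 0))" using y(2) by simp
    then show ?thesis using pow[of "frag_of 0"] r by auto
  qed
  show thesis
  proof (rule that[of ?x], unfold_locales)
    show "?x \<in> carrier G" using gen_c r by simp
    show "k = 0" if "?x [^]\<^bsub>G\<^esub> k = \<one>\<^bsub>G\<^esub>" for k :: int using gen_free that r by simp
    show "\<exists>(n::int) (k::int). n \<noteq> 0 \<and> a [^]\<^bsub>G\<^esub> n = ?x [^]\<^bsub>G\<^esub> k" if "a \<in> carrier G" for a
      using torsion_mod_F[OF that] F_cyclic by blast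
    show "\<exists>j::int. cong_mod n a (?x [^]\<^bsub>G\<^esub> j)" if "a \<in> carrier G" "n \<noteq> 0" for a n
      using divisible_mod_F[OF that] F_cyclic by blast
    show "D = {\<one>\<^bsub>G\<^esub>}" if "subgroup D G" "divisible_group (G\<lparr>carrier := D\<rparr>)" "torsion_group (G\<lparr>carrier := D\<rparr>)" for D
      using qd that by (auto simp: quotient_divisible_def)
  qed
qed

section \<open>Principal absolute ideals\<close>

theorem theorem3p3:
  fixes G :: "('a, 'b) monoid_scheme" and g :: 'a and T :: "'a set"
  assumes "G \<in> QD1"
    and "T = torsion_part G"
    and "g \<in> carrier G"
  shows "(g \<notin> T \<longrightarrow> principal_AI G g = char_subgroup G (characteristic G g)) \<and>
         (g \<in> T \<longrightarrow> principal_AI G g = char_subgroup (G\<lparr>carrier := T\<rparr>) (characteristic G g))"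
proof -
  obtain x where "rank_one_quotient_divisible G x"
    using QD1_imp_rank_one_quotient_divisible[OF assms(1)] .
  then interpret rank_one_quotient_divisible G x .
  note AI = principal_AI_least[OF comm_group_axioms assms(3)]
  note C = char_subgroup_characteristic[OF assms(3)]
  let ?C = "char_subgroup G (characteristic G g)"
  have lower: "h \<in> principal_AI G g" if "h \<in> ?C" "g \<in> T \<longrightarrow> h \<in> T" for h
    using that mem_absolute_ideal[OF AI(1,2), of h] assms(2) by (auto simp: char_subgroup_def)
  have upper: "principal_AI G g \<subseteq> ?C"
    using C by (intro AI(3) absolute_ideal_if_invariant)
  have "principal_AI G g \<subseteq> T \<inter> ?C" if "g \<in> T"
  proof (intro AI(3) absolute_ideal_if_invariant)
    show "subgroup (T \<inter> ?C) G"
      unfolding assms(2) by (intro subgroups_Inter_pair subgroup_torsion_part C(1))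
    show "f a \<in> T \<inter> ?C" if "f \<in> hom G G" "a \<in> T \<inter> ?C" for f a
      using that C(2) torsion_part_invariant unfolding assms(2) by blast
    show "g \<in> T \<inter> ?C" using \<open>g \<in> T\<close> C(3) by blast
  qed
  then show ?thesis
    using lower upper char_subgroup_torsion_part assms(2) by blast
qed

end
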